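(* Let $m_I,m_Q\ge1$ be integers, $M_I=2^{m_I}$, $M_Q=2^{m_Q}$, $E_b>0$, $N_0>0$, $\theta_e\in[-\pi,\pi]$ and $d=\sqrt{\frac{3\log_2(M_IM_Q)E_b}{M_I^2+M_Q^2-2}}$. Consider rectangular $M_I\times M_Q$ QAM over the AWGN channel with phase noise $\theta_e$, with Gray labeling, equiprobable symbols and bit decisions as described in the context. Let $P_{\mathrm{QAM}}(\theta_e)$ be the bit-error rate conditioned on $\theta_e$, i.e. the average of the error probabilities of the $m_I+m_Q$ bits of a symbol, and let $P_{\mathrm e}(i_{m_I,k}\mid\theta_e)$ and $P_{\mathrm e}(q_{m_Q,k}\mid\theta_e)$ be $\frac{1}{m_I+m_Q}$ times the probability, conditioned on $\theta_e$, that the $k$-th bit of the I channel, respectively of the Q channel, is decoded wrongly. Then $$P_{\mathrm{QAM}}(\theta_e)=\sum_{k=1}^{m_I}P_{\mathrm e}(i_{m_I,k}\mid\theta_e)+\sum_{k=1}^{m_Q}P_{\mathrm e}(q_{m_Q,k}\mid\theta_e),$$ where, writing $\Psi(\alpha,x,y,z,\varphi)=\operatorname{erfc}\big(\alpha(x+y\cos\varphi+z\sin\varphi)\big)$ and $\alpha=\frac{d}{\sqrt{N_0}}$, and with the index sets and the numbers $\delta,A$ defined in the context, for $1\le k\le m_I$ $$\begin{aligned} &P_{\mathrm e}(i_{m_I,k}\mid\theta_e)=\frac{1}{2(m_I+m_Q)M_IM_Q}\times\\ &\Bigg(\sum_{\overline p^{(0)}\in\overline{\mathbf p}^{(0)}_k}\sum_{j^{(0)}\in\mathbf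 j^{\overline p^{(0)}}_{m_I,k}}\sum_{p^{(1)}\in\mathbf p^{(1)}_k}\sum_{q=-M_Q/2}^{M_Q/2-1}\Big[\Psi\big(\alpha,\delta^{p^{(1)},l}_{m_I,k},-A^{\overline p^{(0)},j^{(0)}}_{m_I,k},2q+1,\theta_e\big)-\Psi\big(\alpha,\delta^{p^{(1)},u}_{m_I,k},-A^{\overline p^{(0)},j^{(0)}}_{m_I,k},2q+1,\theta_e\big)\Big]\\ &+\sum_{\overline p^{(1)}\in\overline{\mathbf p}^{(1)}_k}\sum_{j^{(1)}\in\mathbf j^{\overline p^{(1)}}_{m_I,k}}\sum_{p^{(0)}\in\mathbf p^{(0)}_k}\sum_{q=-M_Q/2}^{M_Q/2-1}\Big[\Psi\big(\alpha,\delta^{p^{(0)},l}_{m_I,k},-A^{\overline p^{(1)},j^{(1)}}_{m_I,k},2q+1,\theta_e\big)-\Psi\big(\alpha,\delta^{p^{(0)},u}_{m_I,k},-A^{\overline p^{(1)},j^{(1)}}_{m_I,k},2q+1,\theta_e\big)\Big]\Bigg), \end{aligned}$$ and for $1\le k\le m_Q$ $$\begin{aligned} &P_{\mathrm e}(q_{m_Q,k}\mid\theta_e)=\frac{1}{2(m_I+m_Q)M_IM_Q}\times\\ &\Bigg(\sum_{\overline p^{(0)}\in\overline{\mathbf p}^{(0)}_k}\sum_{j^{(0)}\in\mathbf j^{\overline p^{(0)}}_{m_Q,k}}\sum_{p^{(1)}\in\mathbf p^{(1)}_k}\sum_{i=-M_I/2}^{M_I/2-1}\Big[\Psi\big(\alpha,\delta^{p^{(1)},l}_{m_Q,k},-A^{\overline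 p^{(0)},j^{(0)}}_{m_Q,k},-(2i+1),\theta_e\big)-\Psi\big(\alpha,\delta^{p^{(1)},u}_{m_Q,k},-A^{\overline p^{(0)},j^{(0)}}_{m_Q,k},-(2i+1),\theta_e\big)\Big]\\ &+\sum_{\overline p^{(1)}\in\overline{\mathbf p}^{(1)}_k}\sum_{j^{(1)}\in\mathbf j^{\overline p^{(1)}}_{m_Q,k}}\sum_{p^{(0)}\in\mathbf p^{(0)}_k}\sum_{i=-M_I/2}^{M_I/2-1}\Big[\Psi\big(\alpha,\delta^{p^{(0)},l}_{m_Q,k},-A^{\overline p^{(1)},j^{(1)}}_{m_Q,k},-(2i+1),\theta_e\big)-\Psi\big(\alpha,\delta^{p^{(0)},u}_{m_Q,k},-A^{\overline p^{(1)},j^{(1)}}_{m_Q,k},-(2i+1),\theta_e\big)\Big]\Bigg). \end{aligned}$$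
   Context: **Gray code.** $\mathcal{G}_1=(1,0)$; for $n\ge2$, $\mathcal{G}_n$ is the concatenation of the sequence obtained by prefixing (on the left) $1$ to each codeword of $\mathcal{G}_{n-1}$ and the sequence obtained by prefixing $0$ to each codeword of $\mathcal{G}_{n-1}$ listed in reverse order. This is the standard $n$-bit binary reflected Gray code sequence. **Signal model.** A QAM symbol is a pair $(A_I,A_Q)$ with $A_I\in\{\pm d,\pm3d,\dots,\pm(M_I-1)d\}$ and $A_Q\in\{\pm d,\pm3d,\dots,\pm(M_Q-1)d\}$, uniformly distributed over all $M_IM_Q$ pairs. It carries $m_I+m_Q$ bits: the $u$-th codeword of $\mathcal{G}_{m_I}$ is assigned to $A_I=(2u-1-M_I)d$ and the $v$-th codeword of $\mathcal{G}_{m_Q}$ is assigned to $A_Q=(2v-1-M_Q)d$; $i_{m_I,k}$ and $q_{m_Q,k}$ denote the $k$-th bits from the left of the codewords of $A_I$ and of $A_Q$. Given the phase noise value $\theta_e$, the received components are $$r_I=A_I\cos\theta_e-A_Q\sin\theta_e+n_I,\qquad r_Q=A_I\sin\theta_e+A_Q\cos\theta_e+n_Q,$$ where each of $n_I,n_Q$ is Gaussian with mean $0$ and variance $N_0/2$, independent of the symbol. The decision on $i_{m_I,k}$ is the $k$-th bit of the codeword assigned to the I-channel amplitude (in $\{\pm d,\dots,\pm(M_I-1)d\}$) nearest to $r_I$, and the decision on $q_{m_Q,k}$ is the $k$-th bit of the codeword assigned to the Q-channel amplitude (in $\{\pm d,\dots,\pm(M_Q-1)d\}$) nearest to $r_Q$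 (ties, which have probability zero, are broken by any fixed rule). A bit is decoded wrongly if the decision differs from the transmitted bit. In the following, $K\ge1$ and $1\le k\le K$ are integers; the definitions are used with $K=m_I$ and $K=m_Q$. **The function $\Delta$.** $\Delta(-1,K,k)=-\infty$, $\Delta(2^{k-1},K,k)=+\infty$, and for real $x$ with $-1<x<2^{k-1}$, $$\Delta(x,K,k)=-2^K\Big(1-\frac1{2^{k-1}}\Big)+x\cdot2^{K-k+2}.$$ **Decision region endpoints.** $\mathbf{p}^{(1)}_k=\{-1\}$ if $k=1$ and $\{-1,0,\dots,2^{k-2}-1\}$ if $k\ge2$; $\mathbf{p}^{(0)}_k=\{-1\}$ if $k=1$ and $\{-1,0,\dots,2^{k-2}-2\}$ if $k\ge2$ (integers in the range; for $k=2$ this is $\{-1\}$). For $p^{(1)}\in\mathbf{p}^{(1)}_k$: $\delta^{p^{(1)},l}_{K,k}=\Delta(2p^{(1)}+1,K,k)$ and $\delta^{p^{(1)},u}_{K,k}=\Delta(2p^{(1)}+2,K,k)$. For $p^{(0)}\in\mathbf{p}^{(0)}_k$: $\delta^{p^{(0)},l}_{K,k}=\Delta(2p^{(0)}+2,K,k)$ and $\delta^{p^{(0)},u}_{K,k}=\Delta(2p^{(0)}+3,K,k)$. **Bit positions.** $\overline{\mathbf{p}}_k=\left(-\tfrac12,0,1,\dots,2^{k-1}-1,2^{k-1}-\tfrac12\right)$ (for $k=1$: $(-\tfrac12,0,\tfrac12)$). For an element $x$ of $\overline{\mathbf{p}}_k$ other than the last, with successor $x^+$ in $\overline{\mathbf{p}}_k$,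 put $l(x,K,k)=(x^+-x)\cdot2^{K-k+2}$. Further, $\overline{\mathbf{p}}^{(1)}_k=\{-\tfrac34\}$ if $k=1$ and $\{-\tfrac34,0,1,\dots,2^{k-2}-1\}$ if $k\ge2$; and $\overline{\mathbf{p}}^{(0)}_k=\mathbf{p}^{(0)}_k$. For $\overline p^{(1)}\in\overline{\mathbf{p}}^{(1)}_k$: $\mathbf{j}^{\overline p^{(1)}}_{K,k}=\{0,1,\dots,\tfrac12 l(2\overline p^{(1)}+1,K,k)-1\}$ and, for $j$ in this set, $A^{\overline p^{(1)},j}_{K,k}=\Delta(2\overline p^{(1)}+1,K,k)+2j+1$. For $\overline p^{(0)}\in\overline{\mathbf{p}}^{(0)}_k$: $\mathbf{j}^{\overline p^{(0)}}_{K,k}=\{0,1,\dots,\tfrac12 l(2\overline p^{(0)}+2,K,k)-1\}$ and, for $j$ in this set, $A^{\overline p^{(0)},j}_{K,k}=\Delta(2\overline p^{(0)}+2,K,k)+2j+1$. **Conventions.** $\operatorname{erfc}(x)=\frac{2}{\sqrt\pi}\int_x^\infty e^{-t^2}\,dt$, with $\operatorname{erfc}(-\infty)=2$ and $\operatorname{erfc}(+\infty)=0$; accordingly $\Psi(\alpha,-\infty,y,z,\varphi)=2$ and $\Psi(\alpha,+\infty,y,z,\varphi)=0$. *)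

theory Defs
  imports "HOL-Probability.Probability"
begin

section \<open>Gray labelling of amplitudes\<close>

fun gray :: "nat \<Rightarrow> nat list list" where
  "gray 0 = [[]]"
| "gray (Suc 0) = [[1], [0]]"
| "gray (Suc (Suc n)) =
     map (\<lambda>w. 1 # w) (gray (Suc n)) @ map (\<lambda>w. 0 # w) (rev (gray (Suc n)))"

definition amplitudes :: "nat \<Rightarrow> real \<Rightarrow> real set" where
  "amplitudes K d = {a. \<exists>n::nat. odd n \<and> n \<le> 2 ^ K - 1 \<and> (a = real n * d \<or> a = - (real n * d))}"

text \<open>For \<open>d > 0\<close> and \<open>a \<in> amplitudes K d\<close> the index \<open>u\<close> below exists and is unique. Words of a
  labelling are numbered from 1, list positions from 0.\<close>

definition codeword :: "nat \<Rightarrow> real \<Rightarrow> real \<Rightarrow> nat list" where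
  "codeword K d a =
     (THE w. \<exists>u\<in>{1..2 ^ K}. a = (2 * real u - 1 - 2 ^ K) * d \<and> w = gray K ! (u - 1))"

definition kth_bit :: "nat \<Rightarrow> real \<Rightarrow> nat \<Rightarrow> real \<Rightarrow> nat" where
  "kth_bit K d k a = codeword K d a ! (k - 1)"

text \<open>A rule choosing a nearest amplitude for every received value; ties are resolved arbitrarily.\<close>

definition nearest_rule :: "nat \<Rightarrow> real \<Rightarrow> (real \<Rightarrow> real) \<Rightarrow> bool" where
  "nearest_rule K d D \<longleftrightarrow> (\<forall>r. is_arg_min (\<lambda>a. \<bar>r - a\<bar>) (\<lambda>a. a \<in> amplitudes K d) (D r))"

section \<open>Error probabilities\<close>

text \<open>Independence of random variables with values in different types, which \<^const>\<open>prob_space.indep_var\<close>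
  does not cover.\<close>

definition indep_rv ::
  "'w measure \<Rightarrow> 'a measure \<Rightarrow> ('w \<Rightarrow> 'a) \<Rightarrow> 'b measure \<Rightarrow> ('w \<Rightarrow> 'b) \<Rightarrow> bool" where
  "indep_rv \<Omega> M X N Y \<longleftrightarrow>
     X \<in> measurable \<Omega> M \<and> Y \<in> measurable \<Omega> N \<and>
     prob_space.indep_set \<Omega> {X -` A \<inter> space \<Omega> |A. A \<in> sets M} {Y -` B \<inter> space \<Omega> |B. B \<in> sets N}"

definition received_I :: "real \<Rightarrow> real \<times> real \<Rightarrow> real \<Rightarrow> real" where
  "received_I \<theta> s n = fst s * cos \<theta> - snd s * sin \<theta> + n"

definition received_Q :: "real \<Rightarrow> real \<times> real \<Rightarrow> real \<Rightarrow> real" where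
  "received_Q \<theta> s n = fst s * sin \<theta> + snd s * cos \<theta> + n"

definition bit_error_prob ::
  "'w measure \<Rightarrow> nat \<Rightarrow> real \<Rightarrow> ('w \<Rightarrow> real) \<Rightarrow> ('w \<Rightarrow> real) \<Rightarrow> nat \<Rightarrow> real" where
  "bit_error_prob \<Omega> K d sent decided k =
     \<P>(\<omega> in \<Omega>. kth_bit K d k (decided \<omega>) \<noteq> kth_bit K d k (sent \<omega>))"

definition symbol_bits :: "nat \<Rightarrow> nat \<Rightarrow> real \<Rightarrow> real \<times> real \<Rightarrow> nat list" where
  "symbol_bits m\<^sub>I m\<^sub>Q d s = codeword m\<^sub>I d (fst s) @ codeword m\<^sub>Q d (snd s)"

definition bit_error_rate ::
  "'w measure \<Rightarrow> nat \<Rightarrow> nat \<Rightarrow> real \<Rightarrow> ('w \<Rightarrow> real \<times> real) \<Rightarrow> ('w \<Rightarrow> real \<times> real) \<Rightarrow> real" where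
  "bit_error_rate \<Omega> m\<^sub>I m\<^sub>Q d sent decided =
     (\<Sum>b<m\<^sub>I + m\<^sub>Q.
        \<P>(\<omega> in \<Omega>. symbol_bits m\<^sub>I m\<^sub>Q d (decided \<omega>) ! b \<noteq> symbol_bits m\<^sub>I m\<^sub>Q d (sent \<omega>) ! b))
     / real (m\<^sub>I + m\<^sub>Q)"

section \<open>Decision regions and bit positions\<close>

text \<open>All definitions of this section are meant for \<open>1 \<le> k \<le> K\<close>, and \<open>Delta x K k\<close> for
  \<open>-1 \<le> x \<le> 2 ^ (k - 1)\<close>.\<close>

definition Delta :: "real \<Rightarrow> nat \<Rightarrow> nat \<Rightarrow> ereal" where
  "Delta x K k =
     (if x = - 1 then - \<infinity>
      else if x = 2 ^ (k - 1) then \<infinity>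
      else ereal (- (2 ^ K) * (1 - 1 / 2 ^ (k - 1)) + x * 2 ^ (K - k + 2)))"

definition p1_set :: "nat \<Rightarrow> int set" where
  "p1_set k = (if k = 1 then {- 1} else {- 1..2 ^ (k - 2) - 1})"

definition p0_set :: "nat \<Rightarrow> int set" where
  "p0_set k = (if k = 1 then {- 1} else {- 1..2 ^ (k - 2) - 2})"

definition delta1_l :: "nat \<Rightarrow> nat \<Rightarrow> int \<Rightarrow> ereal" where
  "delta1_l K k p = Delta (2 * real_of_int p + 1) K k"

definition delta1_u :: "nat \<Rightarrow> nat \<Rightarrow> int \<Rightarrow> ereal" where
  "delta1_u K k p = Delta (2 * real_of_int p + 2) K k"

definition delta0_l :: "nat \<Rightarrow> nat \<Rightarrow> int \<Rightarrow> ereal" where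
  "delta0_l K k p = Delta (2 * real_of_int p + 2) K k"

definition delta0_u :: "nat \<Rightarrow> nat \<Rightarrow> int \<Rightarrow> ereal" where
  "delta0_u K k p = Delta (2 * real_of_int p + 3) K k"

definition pbar :: "nat \<Rightarrow> real list" where
  "pbar k = [- 1 / 2] @ map real [0..<2 ^ (k - 1)] @ [2 ^ (k - 1) - 1 / 2]"

definition pbar_succ :: "nat \<Rightarrow> real \<Rightarrow> real" where
  "pbar_succ k x =
     (THE y. \<exists>i. Suc i < length (pbar k) \<and> pbar k ! i = x \<and> pbar k ! Suc i = y)"

definition seg_length :: "real \<Rightarrow> nat \<Rightarrow> nat \<Rightarrow> real" where
  "seg_length x K k = (pbar_succ k x - x) * 2 ^ (K - k + 2)"

definition pbar1_set :: "nat \<Rightarrow> real set" where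
  "pbar1_set k =
     (if k = 1 then {- 3 / 4} else insert (- 3 / 4) (real_of_int ` {0..2 ^ (k - 2) - 1}))"

definition pbar0_set :: "nat \<Rightarrow> real set" where
  "pbar0_set k = real_of_int ` p0_set k"

definition j1_set :: "nat \<Rightarrow> nat \<Rightarrow> real \<Rightarrow> nat set" where
  "j1_set K k p = {j. real j \<le> seg_length (2 * p + 1) K k / 2 - 1}"

definition j0_set :: "nat \<Rightarrow> nat \<Rightarrow> real \<Rightarrow> nat set" where
  "j0_set K k p = {j. real j \<le> seg_length (2 * p + 2) K k / 2 - 1}"

text \<open>\<open>Delta\<close> is finite at the arguments occurring in the next two definitions.\<close>

definition A1 :: "nat \<Rightarrow> nat \<Rightarrow> real \<Rightarrow> nat \<Rightarrow> real" where
  "A1 K k p j = real_of_ereal (Delta (2 * p + 1) K k) + 2 * real j + 1"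

definition A0 :: "nat \<Rightarrow> nat \<Rightarrow> real \<Rightarrow> nat \<Rightarrow> real" where
  "A0 K k p j = real_of_ereal (Delta (2 * p + 2) K k) + 2 * real j + 1"

section \<open>Complementary error function\<close>

definition erfc :: "ereal \<Rightarrow> real" where
  "erfc x =
     (case x of
        ereal r \<Rightarrow> 2 / sqrt pi * (LINT t:{r..}|lborel. exp (- (t\<^sup>2)))
      | PInfty \<Rightarrow> 0
      | MInfty \<Rightarrow> 2)"

definition Psi :: "real \<Rightarrow> ereal \<Rightarrow> real \<Rightarrow> real \<Rightarrow> real \<Rightarrow> real" where
  "Psi \<alpha> x y z \<phi> = erfc (ereal \<alpha> * (x + ereal (y * cos \<phi> + z * sin \<phi>)))"

end

(* Number the codewords v = 0, ..., 2^K - 1 and cut this range into 2^k blocks of length 2^(K-k). The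
   k-th bits of the reflected Gray code, read block by block, are 1,0,0,1,1,0,0,1,...: they are
   constant on runs t = 0, ..., 2^(k-1), with value 1 for even t, and in units of d the run t is the
   set of amplitudes between two consecutive values of Delta. A nearest-amplitude decision therefore
   returns 1 exactly when r / d lies between the endpoints of an even run, except for the finitely
   many r on a boundary, which are null for Gaussian noise. So, conditionally on the symbol, the
   error probability is a sum of Gaussian interval probabilities, i.e. of differences of erfc, over
   the runs of opposite parity; averaging over the symbols and enumerating each run by its first
   amplitude and an offset j gives the formula. *)
theory Submission
  imports Defs
begin

section \<open>Runs of equal bits in the Gray code\<close>

text \<open>The amplitude in units of \<open>d\<close>, with the index \<open>v\<close> counted from
  0, so that \<open>v\<close> stands for \<open>u - 1\<close> in the labelling by
  \<open>u\<close>.\<close>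

definition level :: "nat \<Rightarrow> nat \<Rightarrow> real" where
  "level K v = 2 * real v + 1 - 2 ^ K"

text \<open>Adding 1 before halving joins the blocks \<open>2 * t - 1\<close> and
  \<open>2 * t\<close> into run \<open>t\<close>. Block 0 stays alone in run 0, and the last block
  \<open>2 ^ k - 1\<close> stays alone in run \<open>2 ^ (k - 1)\<close>.\<close>

definition run :: "nat \<Rightarrow> nat \<Rightarrow> nat \<Rightarrow> nat" where
  "run K k v = (v div 2 ^ (K - k) + 1) div 2"

lemma length_gray: "length (gray K) = 2 ^ K"
  by (induction K rule: gray.induct) auto

lemma length_codeword_gray: "w \<in> set (gray K) \<Longrightarrow> length w = K"
  by (induction K arbitrary: w rule: gray.induct) auto

text \<open>With \<open>J = 2 ^ (k - 2)\<close>, the left run has a number \<open>J + c\<close> and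
  the reflected one, in the code shorter by one bit, the number \<open>J - c\<close>. They differ by
  \<open>2 * c\<close>, so the parity survives.\<close>

lemma run_reflect:
  assumes "2 \<le> k" "k \<le> Suc n" "x < 2 ^ n"
  shows "even (run (Suc n) k (2 ^ n + x)) = even (run n (k - 1) (2 ^ n - 1 - x))"
proof -
  define w :: nat where "w = 2 ^ (Suc n - k)"
  define j where "j = k - 2"
  have k: "k = j + 2" using assms j_def by simp
  have w0: "w > 0" by (simp add: w_def)
  have n: "n = (Suc n - k) + Suc j" using assms k by simp
  have pn: "(2::nat) ^ n = w * (2 * 2 ^ j)"
    by (subst n) (simp add: w_def power_add del: Nat.diff_Suc)
  define b where "b = x div w"
  have b: "b < 2 * 2 ^ j"
    using assms(3) w0 unfolding b_def pn by (simp add: div_less_iff_less_mult mult.commute)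
  have 1: "(2 ^ n + x) div w = 2 * 2 ^ j + b" using w0 by (simp add: pn b_def)
  \<comment> \<open>Reflection reverses the order of the blocks because \<open>w\<close> divides
    \<open>2 ^ n\<close>: block \<open>b\<close> goes to block
    \<open>2 * 2 ^ j - 1 - b\<close>.\<close>
  have 2: "(2 ^ n - 1 - x) div w = 2 * 2 ^ j - 1 - b"
  proof (rule div_nat_eqI)
    have xb: "w * b \<le> x" "x < w * b + w"
      using w0 by (auto simp: b_def) (metis add.commute dividend_less_times_div mult.commute mult_Suc_right)
    have e: "w * (2 * 2 ^ j - 1 - b) + w * b + w = 2 ^ n"
    proof -
      have "w * (2 * 2 ^ j - 1 - b) + w * b + w = w * ((2 * 2 ^ j - 1 - b) + b + 1)"
        by (simp add: algebra_simps)
      also have "(2 * 2 ^ j - 1 - b) + b + 1 = 2 * 2 ^ j" using b by simp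
      finally show ?thesis using pn by simp
    qed
    show "w * (2 * 2 ^ j - 1 - b) \<le> 2 ^ n - 1 - x" using e xb assms(3) by linarith
    show "2 ^ n - 1 - x < w * Suc (2 * 2 ^ j - 1 - b)" using e xb assms(3) by simp
  qed
  have e1: "run (Suc n) k (2 ^ n + x) = (2 * 2 ^ j + b + 1) div 2"
    using 1 by (simp add: run_def w_def)
  have "n - (k - 1) = Suc n - k" using assms by simp
  then have e2: "run n (k - 1) (2 ^ n - 1 - x) = (2 * 2 ^ j - 1 - b + 1) div 2"
    unfolding run_def using 2 by (simp add: w_def)
  define c where "c = (b + 1) div 2"
  define J :: nat where "J = 2 ^ j"
  have "(2 * J + b + 1) div 2 = J + c" unfolding c_def by simp
  moreover have "(2 * J - 1 - b + 1) div 2 = J - c" "c \<le> J" using b unfolding c_def J_def[symmetric] by presburger+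
  ultimately show ?thesis unfolding e1 e2 J_def[symmetric] by simp
qed

text \<open>Induction along the recursion of \<open>gray\<close>. For \<open>k = 1\<close> the bit
  is the prefix, and the two halves are the runs 0 and 1. For larger \<open>k\<close> the bit comes
  from the shorter code, read forwards in the first half and backwards in the second, where
  \<open>run_reflect\<close> applies.\<close>

lemma gray_nth_bit:
  assumes "1 \<le> k" "k \<le> K" "v < 2 ^ K"
  shows "gray K ! v ! (k - 1) = (if even (run K k v) then 1 else 0)"
  using assms
proof (induction K arbitrary: v k rule: gray.induct)
  case 1
  then show ?case by simp
next
  case 2
  then have "k = 1" "v = 0 \<or> v = 1" by auto
  then show ?case by (auto simp: run_def)
next
  case (3 n)
  show ?case
  proof (cases "v < 2 ^ Suc n")
    case True
    then have nth: "gray (Suc (Suc n)) ! v = 1 # gray (Suc n) ! v"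
      by (simp add: nth_append length_gray)
    show ?thesis
    proof (cases "k = 1")
      case True
      then show ?thesis using \<open>v < 2 ^ Suc n\<close> unfolding nth by (simp add: run_def)
    next
      case False
      then have k: "1 \<le> k - 1" "k - 1 \<le> Suc n" using 3 by auto
      then obtain j where j: "k = Suc (Suc j)" by (metis Suc_diff_1 Suc_le_D diff_is_0_eq' le_0_eq nat_le_linear not_less_eq_eq One_nat_def)
      \<comment> \<open>Dropping the prefix lowers \<open>K\<close> and \<open>k\<close> together,
        so the block length \<open>2 ^ (K - k)\<close> is unchanged.\<close>
      have "run (Suc (Suc n)) k v = run (Suc n) (k - 1) v" using k by (simp add: run_def)
      then show ?thesis unfolding nth using 3(1)[OF k True] j by simp
    qed
  next
    case False
    define x where "x = v - 2 ^ Suc n"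
    have v: "v = 2 ^ Suc n + x" and x: "x < 2 ^ Suc n" using False 3 by (auto simp: x_def)
    have nth: "gray (Suc (Suc n)) ! v = 0 # gray (Suc n) ! (2 ^ Suc n - 1 - x)"
      using x unfolding v by (simp add: nth_append length_gray rev_nth)
    show ?thesis
    proof (cases "k = 1")
      case True
      then show ?thesis using x unfolding nth by (simp add: run_def v)
    next
      case False
      then have k: "1 \<le> k - 1" "k - 1 \<le> Suc n" using 3 by auto
      then obtain j where j: "k = Suc (Suc j)" by (metis Suc_diff_1 Suc_le_D diff_is_0_eq' le_0_eq nat_le_linear not_less_eq_eq One_nat_def)
      have "even (run (Suc (Suc n)) k v) = even (run (Suc n) (k - 1) (2 ^ Suc n - 1 - x))"
        unfolding v by (rule run_reflect) (use k x in auto)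
      then show ?thesis unfolding nth using 3(1)[OF k, of "2 ^ Suc n - 1 - x"] j by simp
    qed
  qed
qed

section \<open>Codewords, bits and amplitudes addressed by index\<close>

lemma codeword_level:
  assumes "d > 0" "v < 2 ^ K"
  shows "codeword K d (level K v * d) = gray K ! v"
  unfolding codeword_def
proof (rule the_equality)
  have "level K v * d = (2 * real (Suc v) - 1 - 2 ^ K) * d" by (simp add: level_def)
  moreover have "Suc v \<in> {1..2 ^ K}" using assms by auto
  ultimately show "\<exists>u\<in>{1..2 ^ K}. level K v * d = (2 * real u - 1 - 2 ^ K) * d \<and> gray K ! v = gray K ! (u - 1)"
    by (intro bexI[of _ "Suc v"]) auto
next
  fix w
  assume "\<exists>u\<in>{1..2 ^ K}. level K v * d = (2 * real u - 1 - 2 ^ K) * d \<and> w = gray K ! (u - 1)"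
  then obtain u where u: "u \<ge> 1" "level K v = 2 * real u - 1 - 2 ^ K" "w = gray K ! (u - 1)"
    using assms by auto
  then have "real u = real (Suc v)" by (simp add: level_def)
  then have "u = Suc v" by (simp only: of_nat_eq_iff)
  then show "w = gray K ! v" using u by auto
qed

lemma kth_bit_level:
  assumes "d > 0" "v < 2 ^ K" "1 \<le> k" "k \<le> K"
  shows "kth_bit K d k (level K v * d) = (if even (run K k v) then 1 else 0)"
  using codeword_level gray_nth_bit assms by (simp add: kth_bit_def)

lemma inj_level: "d \<noteq> 0 \<Longrightarrow> inj (\<lambda>v. level K v * d)"
  by (auto simp: inj_def level_def)

text \<open>With \<open>H = 2 ^ (K - 1)\<close>, the odd multiple \<open>2 * i + 1\<close> of
  \<open>d\<close> has index \<open>H + i\<close>, and its negative has index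
  \<open>H - 1 - i\<close>.\<close>

lemma amplitudes_eq_level:
  assumes "K \<ge> 1"
  shows "amplitudes K d = (\<lambda>v. level K v * d) ` {..<2 ^ K}"
proof -
  obtain j where K: "K = Suc j" using assms by (cases K) auto
  define H :: nat where "H = 2 ^ j"
  have H: "(2::nat) ^ K = 2 * H" "(2::real) ^ K = 2 * real H" by (auto simp: K H_def)
  show ?thesis
  proof (intro equalityI subsetI)
    fix a assume "a \<in> amplitudes K d"
    then obtain n where n: "odd n" "n \<le> 2 * H - 1" "a = real n * d \<or> a = - (real n * d)"
      unfolding amplitudes_def H by auto
    then obtain i where i: "n = 2 * i + 1" by (auto elim: oddE)
    then have iH: "i < H" using n by auto
    from n(3) show "a \<in> (\<lambda>v. level K v * d) ` {..<2 ^ K}"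
    proof
      assume "a = real n * d"
      then have "a = level K (H + i) * d" by (simp add: level_def H i)
      then show ?thesis using iH by (auto simp: H)
    next
      assume "a = - (real n * d)"
      moreover have "real (H - 1 - i) = real H - 1 - real i" using iH by (simp add: of_nat_diff)
      ultimately have "a = level K (H - 1 - i) * d"
        by (simp add: level_def H i algebra_simps)
      then show ?thesis using iH by (auto simp: H)
    qed
  next
    fix a assume "a \<in> (\<lambda>v. level K v * d) ` {..<2 ^ K}"
    then obtain v where v: "v < 2 * H" "a = level K v * d" by (auto simp: H)
    show "a \<in> amplitudes K d"
    proof (cases "v < H")
      case True
      then have "real (2 * (H - 1 - v) + 1) = - level K v"
        by (simp add: level_def H of_nat_diff)
      then have "a = - (real (2 * (H - 1 - v) + 1) * d)" using v by simp
      moreover have "2 * (H - 1 - v) + 1 \<le> 2 * H - 1" "odd (2 * (H - 1 - v) + 1)" using True by auto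
      ultimately show ?thesis unfolding amplitudes_def H by blast
    next
      case False
      then have "real (2 * (v - H) + 1) = level K v"
        by (simp add: level_def H of_nat_diff)
      then have "a = real (2 * (v - H) + 1) * d" using v by simp
      moreover have "2 * (v - H) + 1 \<le> 2 * H - 1" "odd (2 * (v - H) + 1)" using False v by auto
      ultimately show ?thesis unfolding amplitudes_def H by blast
    qed
  qed
qed

section \<open>Boundaries of the decision regions\<close>

text \<open>Shifting the index by one makes the decision region of run \<open>t\<close> the interval from \<open>bound K k t\<close> to
  \<open>bound K k (Suc t)\<close>, including the two unbounded ones.\<close>

definition bound :: "nat \<Rightarrow> nat \<Rightarrow> nat \<Rightarrow> ereal" where
  "bound K k t = Delta (real t - 1) K k"

lemma bound_0: "bound K k 0 = - \<infinity>"
  by (simp add: bound_def Delta_def)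

lemma bound_top: "bound K k (Suc (2 ^ (k - 1))) = \<infinity>"
proof -
  have "(2::real) ^ (k-1) \<noteq> -1" by (smt (verit) zero_le_power)
  then show ?thesis by (simp add: bound_def Delta_def)
qed

text \<open>This form shows block boundaries: \<open>2 * 2 ^ (K - k)\<close> is the width of a block
  in units of \<open>d\<close>, and \<open>- 2 ^ K\<close> lies half a spacing below the smallest
  amplitude.\<close>

lemma Delta_mid:
  assumes "1 \<le> k" "k \<le> K" "x \<noteq> -1" "x \<noteq> 2 ^ (k - 1)"
  shows "Delta x K k = ereal (2 * 2 ^ (K - k) * (2 * x + 1) - 2 ^ K)"
proof -
  obtain j where j: "k = Suc j" using assms by (cases k) auto
  obtain i where i: "K = k + i" using assms le_Suc_ex by blast
  show ?thesis using assms unfolding Delta_def i j by (simp add: field_simps power_add)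
qed

lemma bound_mid:
  assumes "1 \<le> k" "k \<le> K" "1 \<le> t" "t \<le> 2 ^ (k - 1)"
  shows "bound K k t = ereal (2 * 2 ^ (K - k) * (2 * real t - 1) - 2 ^ K)"
proof -
  have "real t \<le> 2 ^ (k - 1)" using assms(4) by (metis of_nat_le_iff of_nat_numeral of_nat_power)
  then have "real t - 1 \<noteq> 2 ^ (k - 1)" by linarith
  then have "Delta (real t - 1) K k = ereal (2 * 2 ^ (K - k) * (2 * (real t - 1) + 1) - 2 ^ K)"
    using assms by (intro Delta_mid) auto
  then show ?thesis by (simp add: bound_def algebra_simps)
qed

text \<open>The finite bounds are affine in the run number with positive slope, and the first and
  the last bound are infinite.\<close>

lemma bound_strict:
  assumes "1 \<le> k" "k \<le> K" "t < t'" "t' \<le> Suc (2 ^ (k - 1))"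
  shows "bound K k t < bound K k t'"
proof (cases "t = 0")
  case True
  then show ?thesis using assms bound_mid[of k K t']
    by (cases "t' = Suc (2 ^ (k - 1))") (auto simp: bound_0 bound_top simp del: One_nat_def)
next
  case False
  then have t: "bound K k t = ereal (2 * 2 ^ (K - k) * (2 * real t - 1) - 2 ^ K)"
    using assms by (intro bound_mid) auto
  show ?thesis
  proof (cases "t' = Suc (2 ^ (k - 1))")
    case True
    then show ?thesis unfolding t by (simp only: bound_top) simp
  next
    case False
    then have "bound K k t' = ereal (2 * 2 ^ (K - k) * (2 * real t' - 1) - 2 ^ K)"
      using assms by (intro bound_mid) auto
    then show ?thesis using t assms by simp
  qed
qed

lemma run_le:
  assumes "1 \<le> k" "k \<le> K" "v < 2 ^ K"
  shows "run K k v \<le> 2 ^ (k - 1)"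
proof -
  have "(2::nat) ^ K = 2 ^ (K - k) * 2 ^ k" using assms by (simp flip: power_add)
  then have "v div 2 ^ (K - k) < 2 ^ k" using assms by (simp add: div_less_iff_less_mult mult.commute)
  moreover have "(2::nat) ^ k = 2 * 2 ^ (k - 1)" using assms by (cases k) auto
  ultimately show ?thesis unfolding run_def by linarith
qed

lemma run_eq_iff:
  assumes "1 \<le> t"
  shows "run K k v = t \<longleftrightarrow> (2 * t - 1) * 2 ^ (K - k) \<le> v \<and> v < (2 * t + 1) * 2 ^ (K - k)"
proof -
  define b where "b = v div 2 ^ (K - k)"
  have "run K k v = t \<longleftrightarrow> 2 * t - 1 \<le> b \<and> b < 2 * t + 1"
    using assms unfolding run_def b_def[symmetric] by auto
  also have "2 * t - 1 \<le> b \<longleftrightarrow> (2 * t - 1) * 2 ^ (K - k) \<le> v"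
    unfolding b_def by (subst less_eq_div_iff_mult_less_eq) auto
  also have "b < 2 * t + 1 \<longleftrightarrow> v < (2 * t + 1) * 2 ^ (K - k)"
    unfolding b_def by (subst div_less_iff_less_mult) auto
  finally show ?thesis .
qed

lemma run_eq_0_iff: "run K k v = 0 \<longleftrightarrow> v < 2 ^ (K - k)"
  unfolding run_def by (auto simp: div_eq_0_iff)

text \<open>Comparison with the two neighbours of the chosen amplitude suffices: they keep
  \<open>r\<close> within \<open>d\<close> of it, and the finite bounds of its run are at least that
  far away. At the outermost runs the bound concerned is infinite.\<close>

lemma nearest_bounds:
  assumes d: "d > 0" and k: "1 \<le> k" "k \<le> K" and D: "nearest_rule K d D"
    and v: "v < 2 ^ K" "D r = level K v * d"
  shows "bound K k (run K k v) \<le> ereal (r / d)" "ereal (r / d) \<le> bound K k (Suc (run K k v))"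
proof -
  have K: "K \<ge> 1" using k by simp
  have near: "\<bar>r - level K v * d\<bar> \<le> \<bar>r - level K u * d\<bar>" if "u < 2 ^ K" for u
  proof -
    have "is_arg_min (\<lambda>a. \<bar>r - a\<bar>) (\<lambda>a. a \<in> amplitudes K d) (D r)"
      using D by (simp add: nearest_rule_def)
    moreover have "level K u * d \<in> amplitudes K d"
      using that unfolding amplitudes_eq_level[OF K] by auto
    ultimately show ?thesis unfolding is_arg_min_def v(2) by (meson not_le)
  qed
  let ?t = "run K k v"
  show "bound K k ?t \<le> ereal (r / d)"
  proof (cases "?t = 0")
    case True
    then show ?thesis by (simp add: bound_0)
  next
    case False
    then have t: "1 \<le> ?t" by simp
    then have lo: "(2 * ?t - 1) * 2 ^ (K - k) \<le> v" using run_eq_iff by blast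
    have v1: "v \<ge> 1"
    proof (rule ccontr)
      assume "\<not> ?thesis"
      then have "v = 0" by simp
      then show False using False by (auto simp: run_def)
    qed
    have "real (v - 1) = real v - 1" using v1 by simp
    then have "level K (v - 1) * d = level K v * d - 2 * d" by (simp add: level_def algebra_simps)
    \<comment> \<open>Being no farther from \<open>level K v * d\<close> than from its lower
      neighbour places \<open>r\<close> on or above the midpoint of the two.\<close>
    with near[of "v - 1"] v d have "r \<ge> level K v * d - d" by linarith
    then have "r \<ge> (level K v - 1) * d" by (simp add: algebra_simps)
    then have "r / d \<ge> 2 * real v - 2 ^ K" using d by (simp add: level_def field_simps)
    moreover have "(2 * real ?t - 1) * 2 ^ (K - k) \<le> real v"
    proof -
      have "real ((2 * ?t - 1) * 2 ^ (K - k)) \<le> real v" using lo of_nat_le_iff by blast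
      then show ?thesis using t by (simp add: of_nat_diff)
    qed
    ultimately show ?thesis using bound_mid[OF k t run_le[OF k v(1)]] by (simp add: algebra_simps)
  qed
  show "ereal (r / d) \<le> bound K k (Suc ?t)"
  proof (cases "?t = 2 ^ (k - 1)")
    case True
    then show ?thesis by (simp only: bound_top) simp
  next
    case False
    then have t: "1 \<le> Suc ?t" "Suc ?t \<le> 2 ^ (k - 1)" using run_le[OF k v(1)] by auto
    have hi: "v < (2 * ?t + 1) * 2 ^ (K - k)"
      using run_eq_iff[of ?t K k v] run_eq_0_iff[of K k v] by (cases "?t = 0") auto
    \<comment> \<open>A run other than the last ends before the last block, which guarantees an
      upper neighbour.\<close>
    have "(2 * ?t + 1) * 2 ^ (K - k) < 2 * 2 ^ (k - 1) * (2::nat) ^ (K - k)"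
      using t by (intro mult_strict_right_mono) auto
    also have "\<dots> = 2 ^ K" using k by (metis One_nat_def Suc_pred less_eq_Suc_le power_Suc power_add le_add_diff_inverse)
    finally have v1: "Suc v < 2 ^ K" using hi by simp
    have "level K (Suc v) * d = level K v * d + 2 * d" by (simp add: level_def algebra_simps)
    with near[OF v1] d have "r \<le> level K v * d + d" by linarith
    then have "r \<le> (level K v + 1) * d" by (simp add: algebra_simps)
    then have "r / d \<le> 2 * real v + 2 - 2 ^ K" using d by (simp add: level_def field_simps)
    moreover have "real v + 1 \<le> (2 * real ?t + 1) * 2 ^ (K - k)"
    proof -
      have "real (Suc v) \<le> real ((2 * ?t + 1) * 2 ^ (K - k))" using hi of_nat_le_iff Suc_leI by blast
      then show ?thesis by (simp add: algebra_simps)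
    qed
    ultimately show ?thesis using bound_mid[OF k t] by (simp add: algebra_simps)
  qed
qed

section \<open>Gaussian tails and mixtures\<close>

text \<open>Finite sets are Lebesgue null. This disposes of ties and of interval endpoints.\<close>

lemma (in prob_space) prob_continuous_finite:
  fixes Z :: "'a \<Rightarrow> real"
  assumes "distributed M lborel Z f" "finite F"
  shows "prob {\<omega>\<in>space M. Z \<omega> \<in> F} = 0"
proof -
  have "F \<in> null_sets lborel" using assms(2) by (rule finite_imp_null_set_lborel)
  then have "emeasure M (Z -` F \<inter> space M) = 0"
    using distributed_emeasure[OF assms(1), of F] nn_integral_null_set[of F lborel f] by auto
  moreover have "Z -` F \<inter> space M = {\<omega>\<in>space M. Z \<omega> \<in> F}" by auto
  ultimately show ?thesis by (simp add: measure_def)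
qed

text \<open>The density is that of a centred Gaussian of variance \<open>1 / 2\<close>, the scaling
  in which the tail is exactly half of \<open>erfc\<close>. The infinite cases agree with the
  conventional values 0 and 2.\<close>

lemma (in prob_space) prob_greater_erfc:
  assumes Z: "distributed M lborel Z (\<lambda>x. ennreal (exp (- (x\<^sup>2)) / sqrt pi))"
  shows "prob {\<omega>\<in>space M. x < ereal (Z \<omega>)} = erfc x / 2"
proof (cases x)
  case PInf
  then show ?thesis by (simp add: erfc_def)
next
  case MInf
  then show ?thesis by (simp add: erfc_def prob_space)
next
  case (real r)
  have [measurable]: "Z \<in> borel_measurable M"
    using distributed_measurable[OF Z] by simp
  have "erfc x / 2 = (\<integral>t. exp (- (t\<^sup>2)) / sqrt pi * indicator {r..} t \<partial>lborel)"
    unfolding real erfc_def set_lebesgue_integral_def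
    by (simp flip: Bochner_Integration.integral_divide_zero add: ac_simps)
  also have "\<dots> = (\<integral>\<omega>. indicator {r..} (Z \<omega>) \<partial>M)"
    by (rule distributed_integral[OF Z]) auto
  also have "\<dots> = (\<integral>\<omega>. indicator {\<omega>\<in>space M. r \<le> Z \<omega>} \<omega> \<partial>M)"
    by (intro Bochner_Integration.integral_cong) (auto simp: indicator_def)
  also have "\<dots> = prob {\<omega>\<in>space M. r \<le> Z \<omega>}" by simp
  also have "{\<omega>\<in>space M. r \<le> Z \<omega>} = {\<omega>\<in>space M. r < Z \<omega>} \<union> {\<omega>\<in>space M. Z \<omega> \<in> {r}}" by auto
  also have "prob \<dots> = prob {\<omega>\<in>space M. r < Z \<omega>} + prob {\<omega>\<in>space M. Z \<omega> \<in> {r}}"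
    by (rule finite_measure_Union) auto
  also have "prob {\<omega>\<in>space M. Z \<omega> \<in> {r}} = 0" by (rule prob_continuous_finite[OF Z]) simp
  finally show ?thesis by (simp add: real)
qed

lemma (in prob_space) prob_between_erfc:
  assumes Z: "distributed M lborel Z (\<lambda>x. ennreal (exp (- (x\<^sup>2)) / sqrt pi))"
    and "x \<le> y"
  shows "prob {\<omega>\<in>space M. x < ereal (Z \<omega>) \<and> ereal (Z \<omega>) < y} = (erfc x - erfc y) / 2"
proof -
  have [measurable]: "Z \<in> borel_measurable M"
    using distributed_measurable[OF Z] by simp
  \<comment> \<open>\<open>?F\<close> accounts for the single point \<open>y\<close> in the tail
    beyond \<open>x\<close>. It is empty if \<open>y\<close> is infinite, and also if
    \<open>x = y\<close>, when that tail does not contain \<open>y\<close>.\<close>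
  let ?F = "{\<omega>\<in>space M. Z \<omega> \<in> (if \<bar>y\<bar> = \<infinity> \<or> x = y then {} else {real_of_ereal y})}"
  have "{\<omega>\<in>space M. x < ereal (Z \<omega>)} =
      {\<omega>\<in>space M. x < ereal (Z \<omega>) \<and> ereal (Z \<omega>) < y} \<union> ({\<omega>\<in>space M. y < ereal (Z \<omega>)} \<union> ?F)"
    using assms(2) by (cases y) (auto simp: less_le_trans le_less_trans)
  then have "prob {\<omega>\<in>space M. x < ereal (Z \<omega>)} =
     prob ({\<omega>\<in>space M. x < ereal (Z \<omega>) \<and> ereal (Z \<omega>) < y} \<union> ({\<omega>\<in>space M. y < ereal (Z \<omega>)} \<union> ?F))" by simp
  also have "\<dots> = prob {\<omega>\<in>space M. x < ereal (Z \<omega>) \<and> ereal (Z \<omega>) < y} + prob ({\<omega>\<in>space M. y < ereal (Z \<omega>)} \<union> ?F)"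
    by (rule finite_measure_Union) (auto split: if_splits)
  also have "prob ({\<omega>\<in>space M. y < ereal (Z \<omega>)} \<union> ?F) = prob {\<omega>\<in>space M. y < ereal (Z \<omega>)} + prob ?F"
    by (rule finite_measure_Union) (auto split: if_splits)
  also have "prob ?F = 0" by (rule prob_continuous_finite[OF Z]) auto
  finally show ?thesis using prob_greater_erfc[OF Z] by (simp add: field_simps)
qed

text \<open>Division by \<open>sqrt N\<close> turns the variance \<open>N / 2\<close> into
  \<open>1 / 2\<close>; this is the source of \<open>sqrt N\<close> in the argument of
  \<open>Psi\<close>.\<close>

lemma (in prob_space) distributed_normal_rescale:
  assumes "distributed M lborel n (normal_density 0 (sqrt (N / 2)))" "N > 0"
  shows "distributed M lborel (\<lambda>\<omega>. n \<omega> / sqrt N) (\<lambda>x. ennreal (exp (- (x\<^sup>2)) / sqrt pi))"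
proof -
  have "distributed M lborel (\<lambda>\<omega>. 0 + 1 / sqrt N * n \<omega>) (normal_density (0 + 1 / sqrt N * 0) (\<bar>1 / sqrt N\<bar> * sqrt (N / 2)))"
    using assms by (intro normal_density_affine) auto
  moreover have "\<bar>1 / sqrt N\<bar> * sqrt (N / 2) = sqrt (1 / 2)"
    using assms(2) by (simp add: real_sqrt_divide)
  moreover have "normal_density 0 (sqrt (1 / 2)) x = exp (- (x\<^sup>2)) / sqrt pi" for x
    by (simp add: normal_density_def)
  ultimately show ?thesis by simp
qed

text \<open>Total probability over the finitely many symbols: independence factors each term, so the
  noise can be studied with the symbol frozen, and uniformity gives every symbol the weight
  \<open>1 / card C\<close>.\<close>

lemma (in prob_space) prob_mixture:
  assumes "finite C" and S: "S \<in> measurable M (count_space C)" "distr M (count_space C) S = uniform_count_measure C"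
    and n: "indep_rv M (count_space C) S borel n"
    and B: "\<And>s. s \<in> C \<Longrightarrow> B s \<in> sets borel"
  shows "prob {\<omega>\<in>space M. n \<omega> \<in> B (S \<omega>)} = (\<Sum>s\<in>C. prob {\<omega>\<in>space M. n \<omega> \<in> B s}) / real (card C)"
proof -
  have [measurable]: "S \<in> measurable M (count_space C)" by fact
  have nm[measurable]: "n \<in> borel_measurable M" using n by (simp add: indep_rv_def)
  have Sin: "S \<omega> \<in> C" if "\<omega> \<in> space M" for \<omega> using measurable_space[OF S(1) that] by simp
  have ev: "n -` B s \<inter> space M \<in> events" "S -` {s} \<inter> space M \<in> events" if "s \<in> C" for s
    using measurable_sets[OF nm B[OF that]] measurable_sets[OF S(1), of "{s}"] that by auto
  have "{\<omega>\<in>space M. n \<omega> \<in> B (S \<omega>)} = (\<Union>s\<in>C. (S -` {s} \<inter> space M) \<inter> (n -` B s \<inter> space M))"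
    using Sin by auto
  also have "prob \<dots> = (\<Sum>s\<in>C. prob ((S -` {s} \<inter> space M) \<inter> (n -` B s \<inter> space M)))"
    using ev by (intro finite_measure_finite_Union) (auto simp: assms disjoint_family_on_def)
  also have "\<dots> = (\<Sum>s\<in>C. prob (n -` B s \<inter> space M) / real (card C))"
  proof (intro sum.cong refl)
    fix s assume s: "s \<in> C"
    have "prob ((S -` {s} \<inter> space M) \<inter> (n -` B s \<inter> space M)) = prob (S -` {s} \<inter> space M) * prob (n -` B s \<inter> space M)"
    proof (rule indep_setD)
      show "indep_set {S -` A \<inter> space M |A. A \<in> sets (count_space C)} {n -` B \<inter> space M |B. B \<in> sets borel}"
        using n by (simp add: indep_rv_def)
    qed (use s B in auto)
    also have "prob (S -` {s} \<inter> space M) = measure (uniform_count_measure C) {s}"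
      unfolding S(2)[symmetric] using s by (subst measure_distr) auto
    also have "\<dots> = 1 / real (card C)" using s assms(1) by (simp add: measure_uniform_count_measure)
    finally show "prob ((S -` {s} \<inter> space M) \<inter> (n -` B s \<inter> space M)) = prob (n -` B s \<inter> space M) / real (card C)" by simp
  qed
  also have "\<dots> = (\<Sum>s\<in>C. prob {\<omega>\<in>space M. n \<omega> \<in> B s}) / real (card C)"
    by (simp add: sum_divide_distrib vimage_def Int_def conj_commute)
  finally show ?thesis .
qed

section \<open>Error probability of a nearest-amplitude decision\<close>

text \<open>Away from the boundaries, \<open>r / d\<close> lies in the open region of exactly one
  run, that of the decided amplitude. The bit is wrong iff this run and the transmitted one have
  opposite parities.\<close>

lemma bit_error_iff_region:
  assumes d: "d > 0" and k: "1 \<le> k" "k \<le> K" and D: "nearest_rule K d D"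
    and u: "u < 2 ^ K"
    and r: "ereal (r / d) \<notin> bound K k ` {..Suc (2 ^ (k - 1))}"
  shows "kth_bit K d k (D r) \<noteq> kth_bit K d k (level K u * d) \<longleftrightarrow>
    (\<exists>t\<in>{t. t \<le> 2 ^ (k - 1) \<and> even t \<noteq> even (run K k u)}.
       bound K k t < ereal (r / d) \<and> ereal (r / d) < bound K k (Suc t))"
proof -
  have "D r \<in> amplitudes K d"
    using D by (auto simp: nearest_rule_def is_arg_min_def)
  then obtain v where v: "v < 2 ^ K" "D r = level K v * d"
    using amplitudes_eq_level[of K d] k by auto
  define T where "T = run K k v"
  have T: "T \<le> 2 ^ (k - 1)" unfolding T_def by (rule run_le[OF k v(1)])
  have "bound K k T \<noteq> ereal (r / d)" "bound K k (Suc T) \<noteq> ereal (r / d)"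
    using r T by (metis atMost_iff image_eqI le_Suc_eq Suc_le_mono)+
  then have rT: "bound K k T < ereal (r / d)" "ereal (r / d) < bound K k (Suc T)"
    using nearest_bounds[OF d k D v] unfolding T_def[symmetric] by auto
  \<comment> \<open>The bounds increase, so the open regions of distinct runs are disjoint.\<close>
  have uniq: "t = T" if t: "t \<le> 2 ^ (k - 1)" "bound K k t < ereal (r / d)" "ereal (r / d) < bound K k (Suc t)" for t
  proof (rule ccontr)
    assume "t \<noteq> T"
    then have "Suc t \<le> T \<or> Suc T \<le> t" by auto
    moreover have "bound K k i \<le> bound K k j" if "i \<le> j" "j \<le> Suc (2 ^ (k - 1))" for i j
      using bound_strict[OF k, of i j] that by (cases "i = j") auto
    ultimately have "bound K k (Suc t) \<le> bound K k T \<or> bound K k (Suc T) \<le> bound K k t" using t T by auto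
    then show False using t rT by (metis less_le_trans less_trans order.asym)
  qed
  have "kth_bit K d k (D r) \<noteq> kth_bit K d k (level K u * d) \<longleftrightarrow> even T \<noteq> even (run K k u)"
    using kth_bit_level[OF d u k] kth_bit_level[OF d v(1) k] by (simp add: v T_def)
  also have "\<dots> \<longleftrightarrow> (\<exists>t\<in>{t. t \<le> 2 ^ (k - 1) \<and> even t \<noteq> even (run K k u)}.
       bound K k t < ereal (r / d) \<and> ereal (r / d) < bound K k (Suc t))"
    using uniq rT T by blast
  finally show ?thesis .
qed

lemma nearest_error_set:
  assumes d: "d > 0" and k: "1 \<le> k" "k \<le> K" and D: "nearest_rule K d D"
    and u: "u < 2 ^ K"
  shows "\<exists>F. finite F \<and> (\<forall>x. x \<notin> F \<longrightarrow>
    (kth_bit K d k (D (c + x)) \<noteq> kth_bit K d k (level K u * d) \<longleftrightarrow>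
      (\<exists>t\<in>{t. t \<le> 2 ^ (k - 1) \<and> even t \<noteq> even (run K k u)}.
         bound K k t < ereal ((c + x) / d) \<and> ereal ((c + x) / d) < bound K k (Suc t))))"
proof (intro exI conjI allI impI)
  \<comment> \<open>\<open>real_of_ereal\<close> sends the infinite bounds to 0, which at most adds
    the harmless point \<open>- c\<close>.\<close>
  let ?F = "(\<lambda>y. real_of_ereal y * d - c) ` bound K k ` {..Suc (2 ^ (k - 1))}"
  show "finite ?F" by simp
  fix x assume x: "x \<notin> ?F"
  have "ereal ((c + x) / d) \<notin> bound K k ` {..Suc (2 ^ (k - 1))}"
  proof
    assume "ereal ((c + x) / d) \<in> bound K k ` {..Suc (2 ^ (k - 1))}"
    moreover have "x = real_of_ereal (ereal ((c + x) / d)) * d - c" using d by simp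
    ultimately show False using x by blast
  qed
  then show "kth_bit K d k (D (c + x)) \<noteq> kth_bit K d k (level K u * d) \<longleftrightarrow>
      (\<exists>t\<in>{t. t \<le> 2 ^ (k - 1) \<and> even t \<noteq> even (run K k u)}.
         bound K k t < ereal ((c + x) / d) \<and> ereal ((c + x) / d) < bound K k (Suc t))"
    by (rule bit_error_iff_region[OF assms])
qed

text \<open>Measurability of the error sets has to be derived: a nearest rule is arbitrary at ties,
  but its error set differs from a finite union of intervals only in finitely many points.\<close>

lemma borel_differ_finite:
  fixes A B F :: "real set"
  assumes "finite F" "B \<in> sets borel" "\<And>x. x \<notin> F \<Longrightarrow> x \<in> A \<longleftrightarrow> x \<in> B"
  shows "A \<in> sets borel"
proof -
  have "A = (B - F) \<union> (A \<inter> F)" using assms(3) by auto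
  moreover have "F \<in> sets borel" "A \<inter> F \<in> sets borel"
    using assms(1) by (auto intro!: borel_closed finite_imp_closed)
  ultimately show ?thesis using assms(2) by (metis sets.Diff sets.Un)
qed

lemma (in prob_space) prob_differ_finite:
  fixes Z :: "'a \<Rightarrow> real"
  assumes Z: "distributed M lborel Z f" and F: "finite F" and B: "B \<in> sets borel"
    and AB: "\<And>x. x \<notin> F \<Longrightarrow> x \<in> A \<longleftrightarrow> x \<in> B"
  shows "prob {\<omega>\<in>space M. Z \<omega> \<in> A} = prob {\<omega>\<in>space M. Z \<omega> \<in> B}"
proof -
  have Zm: "Z \<in> borel_measurable M" using distributed_measurable[OF Z] by simp
  have A: "A \<in> sets borel" by (rule borel_differ_finite[OF F B AB])
  have Fb: "F \<in> sets borel" using F by (auto intro!: borel_closed finite_imp_closed)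
  have ev: "{\<omega>\<in>space M. Z \<omega> \<in> X} \<in> events" if "X \<in> sets borel" for X
    using measurable_sets[OF Zm that] by (simp add: vimage_def Int_def conj_commute)
  have "AE \<omega> in M. Z \<omega> \<notin> F"
  proof (rule AE_I)
    show "{\<omega>\<in>space M. \<not> Z \<omega> \<notin> F} \<subseteq> {\<omega>\<in>space M. Z \<omega> \<in> F}" by auto
    show "emeasure M {\<omega>\<in>space M. Z \<omega> \<in> F} = 0"
      using prob_continuous_finite[OF Z F] by (simp add: emeasure_eq_measure)
  qed (rule ev[OF Fb])
  then show ?thesis
    by (intro finite_measure_eq_AE) (auto intro: ev A B elim!: eventually_mono simp: AB)
qed

text \<open>An increasing affine change of variable that also covers infinite bounds; it carries the
  bounds on \<open>r / d\<close> to the arguments of \<open>erfc\<close>.\<close>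

lemma ereal_scale_between:
  assumes "0 < (\<beta>::real)"
  shows "x < ereal y \<longleftrightarrow> ereal \<beta> * (x + ereal c) < ereal (\<beta> * (y + c))"
    and "ereal y < x \<longleftrightarrow> ereal (\<beta> * (y + c)) < ereal \<beta> * (x + ereal c)"
  using assms by (cases x; simp)+

text \<open>Here \<open>c\<close> is the noise-free received value in units of \<open>d\<close>. Up
  to finitely many points the error set is a disjoint union of intervals \<open>R t\<close>, one for
  each run of the wrong parity, and each interval contributes a difference of
  \<open>erfc\<close>.\<close>

lemma (in prob_space) nearest_error_prob:
  fixes c :: real
  assumes d: "d > 0" and k: "1 \<le> k" "k \<le> K" and D: "nearest_rule K d D"
    and u: "u < 2 ^ K" and N: "N > 0"
    and n: "distributed M lborel n (normal_density 0 (sqrt (N / 2)))"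
  defines "E \<equiv> {x. kth_bit K d k (D (c * d + x)) \<noteq> kth_bit K d k (level K u * d)}"
  shows "E \<in> sets borel"
    and "prob {\<omega>\<in>space M. n \<omega> \<in> E} =
      (\<Sum>t | t \<le> 2 ^ (k - 1) \<and> even t \<noteq> even (run K k u).
         (erfc (ereal (d / sqrt N) * (bound K k t + ereal (- c)))
        - erfc (ereal (d / sqrt N) * (bound K k (Suc t) + ereal (- c)))) / 2)"
proof -
  let ?T = "{t::nat. t \<le> 2 ^ (k - 1) \<and> even t \<noteq> even (run K k u)}"
  define R where "R t = {x. bound K k t < ereal ((c * d + x) / d) \<and> ereal ((c * d + x) / d) < bound K k (Suc t)}" for t
  have fin: "finite ?T" by simp
  have R: "R t \<in> sets borel" for t unfolding R_def by measurable
  then have UR: "(\<Union>t\<in>?T. R t) \<in> sets borel" using fin by blast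
  obtain F where F1: "finite F"
    and F2: "\<forall>x. x \<notin> F \<longrightarrow> (kth_bit K d k (D (c * d + x)) \<noteq> kth_bit K d k (level K u * d) \<longleftrightarrow>
      (\<exists>t\<in>?T. bound K k t < ereal ((c * d + x) / d) \<and> ereal ((c * d + x) / d) < bound K k (Suc t)))"
    using nearest_error_set[OF d k D u, where c = "c * d"] by blast
  have F: "finite F" "\<And>x. x \<notin> F \<Longrightarrow> x \<in> E \<longleftrightarrow> x \<in> (\<Union>t\<in>?T. R t)"
    by (rule F1) (unfold E_def R_def UN_iff mem_Collect_eq, rule F2[rule_format])
  show "E \<in> sets borel" by (rule borel_differ_finite[OF F(1) UR F(2)])
  let ?Z = "\<lambda>\<omega>. n \<omega> / sqrt N"
  note Z = distributed_normal_rescale[OF n N]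
  have nm: "n \<in> borel_measurable M" using distributed_measurable[OF n] by simp
  have disj: "R t \<inter> R t' = {}" if "t < t'" "t' \<le> 2 ^ (k - 1)" for t t'
  proof -
    have "bound K k (Suc t) \<le> bound K k t'"
      using bound_strict[OF k, of "Suc t" t'] that by (cases "Suc t = t'") auto
    then show ?thesis unfolding R_def by (auto dest: less_le_trans less_trans)
  qed
  have "prob {\<omega>\<in>space M. n \<omega> \<in> E} = prob {\<omega>\<in>space M. n \<omega> \<in> (\<Union>t\<in>?T. R t)}"
    by (rule prob_differ_finite[OF n F(1) UR F(2)])
  also have "{\<omega>\<in>space M. n \<omega> \<in> (\<Union>t\<in>?T. R t)} = (\<Union>t\<in>?T. n -` R t \<inter> space M)" by auto
  also have "prob \<dots> = (\<Sum>t\<in>?T. prob (n -` R t \<inter> space M))"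
  proof (rule finite_measure_finite_Union[OF fin])
    show "(\<lambda>t. n -` R t \<inter> space M) ` ?T \<subseteq> events" using measurable_sets[OF nm R] by auto
    show "disjoint_family_on (\<lambda>t. n -` R t \<inter> space M) ?T"
      unfolding disjoint_family_on_def
    proof (intro ballI impI)
      fix t t' assume "t \<in> ?T" "t' \<in> ?T" "t \<noteq> t'"
      then have "R t \<inter> R t' = {}" using disj[of t t'] disj[of t' t] by (cases "t < t'") auto
      then show "(n -` R t \<inter> space M) \<inter> (n -` R t' \<inter> space M) = {}" by auto
    qed
  qed
  also have "\<dots> = (\<Sum>t\<in>?T. (erfc (ereal (d / sqrt N) * (bound K k t + ereal (- c)))
        - erfc (ereal (d / sqrt N) * (bound K k (Suc t) + ereal (- c)))) / 2)"
  proof (intro sum.cong refl)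
    fix t assume t: "t \<in> ?T"
    let ?a = "ereal (d / sqrt N) * (bound K k t + ereal (- c))"
    let ?b = "ereal (d / sqrt N) * (bound K k (Suc t) + ereal (- c))"
    have a: "d / sqrt N > 0" using d N by simp
    \<comment> \<open>Subtracting the noise-free part \<open>c\<close> and scaling by
      \<open>d / sqrt N\<close> leaves the normalized noise.\<close>
    have eq: "d / sqrt N * ((c * d + x) / d + - c) = x / sqrt N" for x
      using d by (simp add: field_simps)
    have "\<omega> \<in> n -` R t \<inter> space M \<longleftrightarrow> \<omega> \<in> {\<omega>\<in>space M. ?a < ereal (?Z \<omega>) \<and> ereal (?Z \<omega>) < ?b}" for \<omega>
      using ereal_scale_between[OF a, where c = "- c" and y = "(c * d + n \<omega>) / d"]
      unfolding R_def eq by blast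
    then have "n -` R t \<inter> space M = {\<omega>\<in>space M. ?a < ereal (?Z \<omega>) \<and> ereal (?Z \<omega>) < ?b}" by blast
    moreover have "?a \<le> ?b"
      using bound_strict[OF k, of t "Suc t"] t a
      by (intro ereal_mult_left_mono add_mono) auto
    ultimately show "prob (n -` R t \<inter> space M) = (erfc ?a - erfc ?b) / 2"
      using prob_between_erfc[OF Z] by simp
  qed
  finally show "prob {\<omega>\<in>space M. n \<omega> \<in> E} = \<dots>" .
qed

section \<open>Enumeration of the runs\<close>

text \<open>The argument at which \<open>Delta\<close> is the left end of run \<open>t\<close>; for \<open>t = 0\<close> the paper replaces the infinite
  \<open>Delta (- 1)\<close> by \<open>Delta (- 1 / 2) = - 2 ^ K\<close>.\<close>

definition segment_start :: "nat \<Rightarrow> real" where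
  "segment_start t = (if t = 0 then - 1 / 2 else real t - 1)"

lemma length_pbar: "length (pbar k) = 2 ^ (k - 1) + 2"
  by (simp add: pbar_def)

lemma nth_pbar: "t \<le> 2 ^ (k - 1) \<Longrightarrow> pbar k ! t = segment_start t"
  by (cases t) (auto simp: pbar_def segment_start_def nth_append)

lemma nth_pbar_last: "pbar k ! Suc (2 ^ (k - 1)) = 2 ^ (k - 1) - 1 / 2"
  by (simp add: pbar_def nth_append)

lemma inj_segment_start: "segment_start s = segment_start t \<Longrightarrow> s = t"
proof -
  \<comment> \<open>Only the start of run 0 is not an integer, so it cannot coincide with another
    start.\<close>
  have "real t - 1 \<noteq> - 1 / 2" for t :: nat
  proof
    assume "real t - 1 = - 1 / 2"
    then have "real (2 * t) = real 1" by simp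
    then have "2 * t = 1" by (simp only: of_nat_eq_iff)
    then show False by presburger
  qed
  then show "segment_start s = segment_start t \<Longrightarrow> s = t"
    by (auto simp: segment_start_def split: if_splits)
qed

lemma pbar_succ_segment_start:
  assumes "t \<le> 2 ^ (k - 1)"
  shows "pbar_succ k (segment_start t) = pbar k ! Suc t"
  unfolding pbar_succ_def
proof (rule the_equality)
  show "\<exists>i. Suc i < length (pbar k) \<and> pbar k ! i = segment_start t \<and> pbar k ! Suc i = pbar k ! Suc t"
    using assms nth_pbar[OF assms] by (intro exI[of _ t]) (simp add: length_pbar)
next
  fix y
  assume "\<exists>i. Suc i < length (pbar k) \<and> pbar k ! i = segment_start t \<and> pbar k ! Suc i = y"
  then obtain i where i: "i \<le> 2 ^ (k - 1)" "pbar k ! i = segment_start t" "pbar k ! Suc i = y"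
    by (auto simp: length_pbar less_Suc_eq_le simp del: One_nat_def)
  then show "y = pbar k ! Suc t" using nth_pbar[OF i(1)] inj_segment_start by metis
qed

text \<open>The index of the first codeword of run \<open>t\<close>. For \<open>t = 0\<close> the
  truncated subtraction gives the desired value 0.\<close>

definition segment_index :: "nat \<Rightarrow> nat \<Rightarrow> nat \<Rightarrow> nat" where
  "segment_index K k t = (2 * t - 1) * 2 ^ (K - k)"

text \<open>The first and the last run consist of one block, all others of two.\<close>

definition segment_size :: "nat \<Rightarrow> nat \<Rightarrow> nat \<Rightarrow> nat" where
  "segment_size K k t = (if t = 0 \<or> t = 2 ^ (k - 1) then 1 else 2) * 2 ^ (K - k)"

text \<open>Consecutive entries of \<open>pbar k\<close> differ by 1, except for gaps of
  \<open>1 / 2\<close> at both ends, matching runs of two blocks and of one. The factor 2 is the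
  spacing of the amplitudes in units of \<open>d\<close>.\<close>

lemma seg_length_segment:
  assumes "1 \<le> k" "k \<le> K" "t \<le> 2 ^ (k - 1)"
  shows "seg_length (segment_start t) K k = 2 * real (segment_size K k t)"
proof -
  have s: "seg_length (segment_start t) K k = (pbar k ! Suc t - segment_start t) * 4 * 2 ^ (K - k)"
    by (simp add: seg_length_def pbar_succ_segment_start[OF assms(3)])
  show ?thesis
  proof (cases "t = 2 ^ (k - 1)")
    case True
    have "real t = 2 ^ (k - 1)" "t \<noteq> 0" using True by auto
    then have "pbar k ! Suc t - segment_start t = 1 / 2"
      using True nth_pbar_last[of k] by (simp add: segment_start_def)
    then show ?thesis unfolding s using True by (simp add: segment_size_def)
  next
    case False
    then have "Suc t \<le> 2 ^ (k - 1)" using assms by simp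
    then have n: "pbar k ! Suc t = real t" by (simp add: nth_pbar segment_start_def)
    show ?thesis unfolding s n using False by (simp add: segment_start_def segment_size_def)
  qed
qed

text \<open>The value lies one unit below the first amplitude of the run, which explains the offsets
  \<open>2 * j + 1\<close> in \<open>A0\<close> and \<open>A1\<close>.\<close>

lemma Delta_segment_start:
  assumes "1 \<le> k" "k \<le> K" "t \<le> 2 ^ (k - 1)"
  shows "real_of_ereal (Delta (segment_start t) K k) = 2 * real (segment_index K k t) - 2 ^ K"
proof (cases "t = 0")
  case True
  have "(2::real) ^ (k - 1) > 0" by simp
  then have "- 1 / 2 \<noteq> (2::real) ^ (k - 1)" by linarith
  then show ?thesis using True Delta_mid[OF assms(1,2), of "-1/2"]
    by (simp add: segment_start_def segment_index_def)
next
  case False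
  then show ?thesis using bound_mid[OF assms(1,2), of t] assms
    by (simp add: segment_start_def segment_index_def bound_def of_nat_diff)
qed

lemma run_class_eq_segment:
  assumes "1 \<le> k" "k \<le> K" "t \<le> 2 ^ (k - 1)"
  shows "{v. v < 2 ^ K \<and> run K k v = t} =
    {segment_index K k t..<segment_index K k t + segment_size K k t}"
proof -
  define w :: nat where "w = 2 ^ (K - k)"
  define H :: nat where "H = 2 ^ (k - 1)"
  have N: "(2::nat) ^ K = 2 * H * w" unfolding H_def w_def using assms
    by (metis Suc_diff_1 less_eq_Suc_le One_nat_def power_Suc power_add le_add_diff_inverse)
  have w: "w > 0" "H > 0" by (simp_all add: w_def H_def)
  show ?thesis
  proof (cases "t = 0")
    case True
    define X where "X = 2 * H * w"
    have "w \<le> X" using w by (simp add: X_def)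
    then show ?thesis using True unfolding segment_index_def segment_size_def N True run_eq_0_iff
        w_def[symmetric] X_def[symmetric] by auto
  next
    case False
    then have t: "1 \<le> t" "t \<le> H" using assms by (auto simp: H_def)
    have e: "(2 * t + 1) * w = (2 * t - 1) * w + 2 * w"
    proof -
      have "2 * t + 1 = (2 * t - 1) + 2" using t by simp
      then show ?thesis by (metis add_mult_distrib)
    qed
    have e2: "2 * t * w = (2 * t - 1) * w + w"
    proof -
      have "2 * t = (2 * t - 1) + 1" using t by simp
      then show ?thesis by (metis add_mult_distrib mult_1)
    qed
    show ?thesis
    proof (cases "t = H")
      \<comment> \<open>In the last run the upper limit \<open>(2 * t + 1) * w\<close> exceeds
        \<open>2 ^ K\<close>, so the condition \<open>v < 2 ^ K\<close> cuts off the second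
        block.\<close>
      case True
      have "(2 * t + 1) * w \<ge> 2 * t * w" by simp
      then show ?thesis using True e2 unfolding segment_index_def segment_size_def N
          H_def[symmetric] w_def[symmetric] run_eq_iff[OF t(1)] by auto
    next
      case False
      have "(2 * t + 1) * w \<le> 2 * H * w" using t False by (intro mult_right_mono) auto
      then show ?thesis using False t e unfolding segment_index_def segment_size_def N
          H_def[symmetric] w_def[symmetric] run_eq_iff[OF t(1)] by auto
    qed
  qed
qed

lemma sum_run_class:
  fixes f :: "real \<Rightarrow> real"
  assumes "1 \<le> k" "k \<le> K" "t \<le> 2 ^ (k - 1)"
  shows "(\<Sum>v | v < 2 ^ K \<and> run K k v = t. f (level K v)) =
    (\<Sum>j | real j \<le> seg_length (segment_start t) K k / 2 - 1.
        f (real_of_ereal (Delta (segment_start t) K k) + 2 * real j + 1))"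
proof -
  let ?a = "segment_index K k t" and ?n = "segment_size K k t"
  have "(\<Sum>v | v < 2 ^ K \<and> run K k v = t. f (level K v)) = (\<Sum>v\<in>{0 + ?a..<?n + ?a}. f (level K v))"
    unfolding run_class_eq_segment[OF assms] by (simp add: add.commute)
  also have "\<dots> = (\<Sum>j<?n. f (level K (j + ?a)))"
    by (subst sum.shift_bounds_nat_ivl) (simp add: atLeast0LessThan)
  also have "\<dots> = (\<Sum>j | real j \<le> seg_length (segment_start t) K k / 2 - 1.
        f (real_of_ereal (Delta (segment_start t) K k) + 2 * real j + 1))"
    unfolding seg_length_segment[OF assms] Delta_segment_start[OF assms]
    by (intro sum.cong) (auto simp: level_def algebra_simps)
  finally show ?thesis .
qed

lemma sum_by_run:
  fixes f :: "real \<Rightarrow> real"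
  assumes "1 \<le> k" "k \<le> K"
  shows "(\<Sum>v | v < 2 ^ K \<and> P (run K k v). f (level K v)) =
    (\<Sum>t | t \<le> 2 ^ (k - 1) \<and> P t. \<Sum>j | real j \<le> seg_length (segment_start t) K k / 2 - 1.
        f (real_of_ereal (Delta (segment_start t) K k) + 2 * real j + 1))"
proof -
  have "(\<Sum>v | v < 2 ^ K \<and> P (run K k v). f (level K v)) =
    (\<Sum>t | t \<le> 2 ^ (k - 1) \<and> P t. \<Sum>v | v \<in> {v. v < 2 ^ K \<and> P (run K k v)} \<and> run K k v = t. f (level K v))"
    by (subst sum.group) (auto simp del: One_nat_def intro: run_le[OF assms])
  also have "\<dots> = (\<Sum>t | t \<le> 2 ^ (k - 1) \<and> P t. \<Sum>v | v < 2 ^ K \<and> run K k v = t. f (level K v))"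
    by (intro sum.cong) auto
  finally show ?thesis using sum_run_class[OF assms] by simp
qed

section \<open>Matching the index sets with even and odd runs\<close>

lemma power_pred_double: "2 \<le> k \<Longrightarrow> (2::'a::comm_semiring_1) ^ (k - 1) = 2 * 2 ^ (k - 2)"
  by (metis One_nat_def Suc_diff_Suc Suc_1 Suc_le_eq power_Suc)

text \<open>The interval attached to \<open>p\<close> starts at \<open>Delta (2 * p + 1)\<close>,
  that is at \<open>bound K k t\<close> with \<open>t = 2 * p + 2\<close>; the map solves this for
  \<open>p\<close>.\<close>

lemma bij_p1_set:
  assumes "1 \<le> k"
  shows "bij_betw (\<lambda>t. int t div 2 - 1) {t. t \<le> 2 ^ (k - 1) \<and> even t} (p1_set k)"
proof (cases "k = 1")
  case True
  have "{t. t \<le> 2 ^ (k - 1) \<and> even t} = {0::nat}" using True by (auto simp: le_Suc_eq)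
  then show ?thesis using True by (auto simp: p1_set_def bij_betw_def)
next
  case False
  define H :: nat where "H = 2 ^ (k - 2)"
  have H: "(2::nat) ^ (k - 1) = 2 * H" "(2::int) ^ (k - 2) = int H"
    using assms False power_pred_double[of k] by (auto simp: H_def)
  show ?thesis unfolding p1_set_def H using False
    by (auto intro!: bij_betwI[where g = "\<lambda>p. 2 * nat (p + 1)"])
qed

text \<open>Here the interval starts at \<open>Delta (2 * p + 2)\<close>, so
  \<open>t = 2 * p + 3\<close>.\<close>

lemma bij_p0_set:
  assumes "1 \<le> k"
  shows "bij_betw (\<lambda>t. (int t - 3) div 2) {t. t \<le> 2 ^ (k - 1) \<and> odd t} (p0_set k)"
proof (cases "k = 1")
  case True
  have "{t. t \<le> 2 ^ (k - 1) \<and> odd t} = {1::nat}" using True by (auto simp: le_Suc_eq)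
  then show ?thesis using True by (auto simp: p0_set_def bij_betw_def)
next
  case False
  define H :: nat where "H = 2 ^ (k - 2)"
  have H: "(2::nat) ^ (k - 1) = 2 * H" "(2::int) ^ (k - 2) = int H"
    using assms False power_pred_double[of k] by (auto simp: H_def)
  show ?thesis unfolding p0_set_def H using False
    by (auto intro!: bij_betwI[where g = "\<lambda>p. 2 * nat (p + 1) + 1"] elim!: oddE)
qed

lemma sum_p1_set:
  assumes "1 \<le> k"
  shows "(\<Sum>p\<in>p1_set k. f (delta1_l K k p) (delta1_u K k p)) =
    (\<Sum>t | t \<le> 2 ^ (k - 1) \<and> even t. f (bound K k t) (bound K k (Suc t)))"
  unfolding sum.reindex_bij_betw[OF bij_p1_set[OF assms], symmetric]
  by (intro sum.cong) (auto simp: delta1_l_def delta1_u_def bound_def elim!: evenE)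

lemma sum_p0_set:
  assumes "1 \<le> k"
  shows "(\<Sum>p\<in>p0_set k. f (delta0_l K k p) (delta0_u K k p)) =
    (\<Sum>t | t \<le> 2 ^ (k - 1) \<and> odd t. f (bound K k t) (bound K k (Suc t)))"
  unfolding sum.reindex_bij_betw[OF bij_p0_set[OF assms], symmetric]
  by (intro sum.cong) (auto simp: delta0_l_def delta0_u_def bound_def elim!: oddE)

text \<open>The pairs of \<open>p\<close> and \<open>j\<close> list every amplitude with bit 0
  exactly once: \<open>p\<close> selects an odd run and \<open>j\<close> the place within
  it.\<close>

lemma sum_pbar0_set:
  fixes f :: "real \<Rightarrow> real"
  assumes "1 \<le> k" "k \<le> K"
  shows "(\<Sum>p\<in>pbar0_set k. \<Sum>j\<in>j0_set K k p. f (A0 K k p j)) =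
    (\<Sum>v | v < 2 ^ K \<and> odd (run K k v). f (level K v))"
proof -
  have "(\<Sum>p\<in>pbar0_set k. \<Sum>j\<in>j0_set K k p. f (A0 K k p j)) =
      (\<Sum>p\<in>p0_set k. \<Sum>j\<in>j0_set K k (real_of_int p). f (A0 K k (real_of_int p) j))"
    unfolding pbar0_set_def by (subst sum.reindex) (auto simp: inj_on_def)
  also have "\<dots> = (\<Sum>t | t \<le> 2 ^ (k - 1) \<and> odd t. \<Sum>j | real j \<le> seg_length (segment_start t) K k / 2 - 1.
        f (real_of_ereal (Delta (segment_start t) K k) + 2 * real j + 1))"
    unfolding sum.reindex_bij_betw[OF bij_p0_set[OF assms(1)], symmetric]
    by (intro sum.cong) (auto simp: A0_def j0_set_def segment_start_def elim!: oddE)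
  finally show ?thesis using sum_by_run[OF assms, of f odd] by simp
qed

lemma sum_pbar1_set:
  fixes f :: "real \<Rightarrow> real"
  assumes "1 \<le> k" "k \<le> K"
  shows "(\<Sum>p\<in>pbar1_set k. \<Sum>j\<in>j1_set K k p. f (A1 K k p j)) =
    (\<Sum>v | v < 2 ^ K \<and> even (run K k v). f (level K v))"
proof -
  let ?E = "{t::nat. t \<le> 2 ^ (k - 1) \<and> even t}"
  \<comment> \<open>\<open>?h\<close> solves \<open>2 * p + 1 = segment_start t\<close> for
    \<open>p\<close>; at run 0 the start \<open>- 1 / 2\<close> yields the exceptional element
    \<open>- 3 / 4\<close>.\<close>
  let ?h = "\<lambda>t. (segment_start t - 1) / 2"
  have "?h ` ?E = pbar1_set k"
  proof -
    have "?h ` ?E = ?h ` insert 0 (?E - {0})" by (rule arg_cong[where f = "image ?h"]) auto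
    then have "?h ` ?E = insert (- 3 / 4) (?h ` (?E - {0}))"
      by (simp only: image_insert) (simp add: segment_start_def)
    also have "?h ` (?E - {0}) = (if k = 1 then {} else real_of_int ` {0..2 ^ (k - 2) - 1})"
    proof (cases "k = 1")
      case True
      then show ?thesis by (auto simp: le_Suc_eq)
    next
      case False
      define H :: nat where "H = 2 ^ (k - 2)"
      have H: "(2::nat) ^ (k - 1) = 2 * H" "(2::int) ^ (k - 2) = int H"
        using assms False power_pred_double[of k] by (auto simp: H_def)
      have "?h ` ({t. t \<le> 2 * H \<and> even t} - {0}) = real_of_int ` {0..int H - 1}"
      proof (intro equalityI subsetI)
        fix x assume "x \<in> ?h ` ({t. t \<le> 2 * H \<and> even t} - {0})"
        then obtain t where t: "t \<le> 2 * H" "even t" "t \<noteq> 0" "x = ?h t" by blast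
        then obtain s where "t = 2 * s" by blast
        then have s: "s \<le> H" "s > 0" "x = (segment_start (2 * s) - 1) / 2" using t by auto
        then have "x = real_of_int (int s - 1)" by (simp add: segment_start_def)
        moreover have "int s - 1 \<in> {0..int H - 1}" using s by auto
        ultimately show "x \<in> real_of_int ` {0..int H - 1}" by blast
      next
        fix x assume "x \<in> real_of_int ` {0..int H - 1}"
        then obtain p where p: "0 \<le> p" "p < int H" "x = real_of_int p" by auto
        then have "x = ?h (2 * nat p + 2)" by (simp add: segment_start_def)
        moreover have "2 * nat p + 2 \<in> {t. t \<le> 2 * H \<and> even t} - {0}" using p by auto
        ultimately show "x \<in> ?h ` ({t. t \<le> 2 * H \<and> even t} - {0})" by blast
      qed
      then show ?thesis unfolding H using False by (simp only: if_False)
    qed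
    finally show ?thesis by (simp add: pbar1_set_def)
  qed
  then have bij: "bij_betw ?h ?E (pbar1_set k)"
    by (auto simp: bij_betw_def inj_on_def dest: inj_segment_start)
  have h: "2 * ?h t + 1 = segment_start t" for t by (simp add: field_simps)
  have "(\<Sum>p\<in>pbar1_set k. \<Sum>j\<in>j1_set K k p. f (A1 K k p j)) =
    (\<Sum>t\<in>?E. \<Sum>j | real j \<le> seg_length (segment_start t) K k / 2 - 1.
        f (real_of_ereal (Delta (segment_start t) K k) + 2 * real j + 1))"
    unfolding sum.reindex_bij_betw[OF bij, symmetric] A1_def j1_set_def h by (rule refl)
  then show ?thesis using sum_by_run[OF assms, of f even] by simp
qed

text \<open>The substitution \<open>q = u - 2 ^ (L - 1)\<close> centres the index and makes the
  level equal to \<open>2 * q + 1\<close>.\<close>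

lemma sum_level:
  assumes "L \<ge> 1"
  shows "(\<Sum>u<2 ^ L. f (level L u)) =
    (\<Sum>q = - (int (2 ^ L) div 2)..int (2 ^ L) div 2 - 1. f (2 * real_of_int q + 1))"
proof -
  define H :: nat where "H = 2 ^ (L - 1)"
  have H: "(2::nat) ^ L = 2 * H" "(2::real) ^ L = 2 * real H" using assms
    by (cases L; simp add: H_def)+
  have "bij_betw (\<lambda>u. int u - int H) {..<2 ^ L} {- (int (2 ^ L) div 2)..int (2 ^ L) div 2 - 1}"
    unfolding H by (auto intro!: bij_betwI[where g = "\<lambda>q. nat (q + int H)"])
  from sum.reindex_bij_betw[OF this, of "\<lambda>q. f (2 * real_of_int q + 1)"] show ?thesis
    by (simp add: level_def H algebra_simps)
qed

section \<open>The bit error rate\<close>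

text \<open>Both channels are instances: \<open>own\<close> is the amplitude carrying the bit, \<open>oth\<close> the interfering one, and
  \<open>\<epsilon>\<close> is \<open>1\<close> for the I channel and \<open>- 1\<close> for the Q channel.\<close>

lemma (in prob_space) channel_bit_error_prob:
  fixes own oth :: "'s \<Rightarrow> real" and \<epsilon> \<theta> :: real
  assumes d: "d > 0" and k: "1 \<le> k" "k \<le> K" and L: "L \<ge> 1" and D: "nearest_rule K d D"
    and N: "N > 0" and n: "distributed M lborel n (normal_density 0 (sqrt (N / 2)))"
    and C: "finite C" "card C = 2 ^ K * 2 ^ L"
    and S: "S \<in> measurable M (count_space C)" "distr M (count_space C) S = uniform_count_measure C"
    and indep: "indep_rv M (count_space C) S borel n"
    and sumC: "\<And>G :: real \<Rightarrow> real \<Rightarrow> real. (\<Sum>s\<in>C. G (own s) (oth s)) =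
      (\<Sum>v<2 ^ K. \<Sum>u<2 ^ L. G (level K v * d) (level L u * d))"
    and own: "\<And>s. s \<in> C \<Longrightarrow> own s \<in> amplitudes K d"
  shows "bit_error_prob M K d (\<lambda>\<omega>. own (S \<omega>))
      (\<lambda>\<omega>. D (own (S \<omega>) * cos \<theta> - \<epsilon> * oth (S \<omega>) * sin \<theta> + n \<omega>)) k =
    1 / (2 * 2 ^ K * 2 ^ L) *
      ((\<Sum>pb0\<in>pbar0_set k. \<Sum>j0\<in>j0_set K k pb0. \<Sum>p1\<in>p1_set k.
          \<Sum>q = - (int (2 ^ L) div 2)..int (2 ^ L) div 2 - 1.
            Psi (d / sqrt N) (delta1_l K k p1) (- A0 K k pb0 j0) (\<epsilon> * (2 * real_of_int q + 1)) \<theta>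
          - Psi (d / sqrt N) (delta1_u K k p1) (- A0 K k pb0 j0) (\<epsilon> * (2 * real_of_int q + 1)) \<theta>)
     + (\<Sum>pb1\<in>pbar1_set k. \<Sum>j1\<in>j1_set K k pb1. \<Sum>p0\<in>p0_set k.
          \<Sum>q = - (int (2 ^ L) div 2)..int (2 ^ L) div 2 - 1.
            Psi (d / sqrt N) (delta0_l K k p0) (- A1 K k pb1 j1) (\<epsilon> * (2 * real_of_int q + 1)) \<theta>
          - Psi (d / sqrt N) (delta0_u K k p0) (- A1 K k pb1 j1) (\<epsilon> * (2 * real_of_int q + 1)) \<theta>))"
proof -
  let ?\<alpha> = "d / sqrt N"
  let ?T = "\<lambda>v. {t::nat. t \<le> 2 ^ (k - 1) \<and> even t \<noteq> even (run K k v)}"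
  define H where "H x y a b = Psi ?\<alpha> a (- x) (\<epsilon> * y) \<theta> - Psi ?\<alpha> b (- x) (\<epsilon> * y) \<theta>" for x y a b
  define F where "F Q x = (\<Sum>t | t \<le> 2 ^ (k - 1) \<and> Q t. \<Sum>u<2 ^ L. H x (level L u) (bound K k t) (bound K k (Suc t)))"
    for Q :: "nat \<Rightarrow> bool" and x
  define E where "E a b = {x. kth_bit K d k (D (a * cos \<theta> - \<epsilon> * b * sin \<theta> + x)) \<noteq> kth_bit K d k a}" for a b
  have E: "E (level K v * d) (y * d) \<in> sets borel"
    "prob {\<omega>\<in>space M. n \<omega> \<in> E (level K v * d) (y * d)} =
      (\<Sum>t\<in>?T v. H (level K v) y (bound K k t) (bound K k (Suc t))) / 2"
    if v: "v < 2 ^ K" for v y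
  proof -
    \<comment> \<open>The noise-free received value in units of \<open>d\<close>; its negative is
      the trigonometric part of the argument of \<open>Psi\<close>.\<close>
    define c where "c = level K v * cos \<theta> - \<epsilon> * y * sin \<theta>"
    have "E (level K v * d) (y * d) = {x. kth_bit K d k (D (c * d + x)) \<noteq> kth_bit K d k (level K v * d)}"
      unfolding E_def c_def by (simp add: algebra_simps)
    moreover have "- c = - level K v * cos \<theta> + \<epsilon> * y * sin \<theta>" by (simp add: c_def)
    ultimately show "E (level K v * d) (y * d) \<in> sets borel"
      "prob {\<omega>\<in>space M. n \<omega> \<in> E (level K v * d) (y * d)} =
      (\<Sum>t\<in>?T v. H (level K v) y (bound K k t) (bound K k (Suc t))) / 2"
      using nearest_error_prob[OF d k D v N n, of c] unfolding H_def Psi_def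
      by (simp_all only: sum_divide_distrib)
  qed
  have K: "1 \<le> K" using k by simp
  \<comment> \<open>The mixture requires a Borel error set for every symbol. \<open>E\<close> allows
    any real interference, here \<open>oth s / d\<close>.\<close>
  have Em: "E (own s) (oth s) \<in> sets borel" if s: "s \<in> C" for s
  proof -
    obtain v where "v < 2 ^ K" "own s = level K v * d"
      using own[OF s] amplitudes_eq_level[OF K, of d] by auto
    then show ?thesis using E(1)[of v "oth s / d"] d by simp
  qed
  have "bit_error_prob M K d (\<lambda>\<omega>. own (S \<omega>))
      (\<lambda>\<omega>. D (own (S \<omega>) * cos \<theta> - \<epsilon> * oth (S \<omega>) * sin \<theta> + n \<omega>)) k
    = prob {\<omega>\<in>space M. n \<omega> \<in> E (own (S \<omega>)) (oth (S \<omega>))}"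
    by (simp add: bit_error_prob_def E_def)
  also have "\<dots> = (\<Sum>s\<in>C. prob {\<omega>\<in>space M. n \<omega> \<in> E (own s) (oth s)}) / real (card C)"
    by (rule prob_mixture[OF C(1) S indep, of "\<lambda>s. E (own s) (oth s)"]) (rule Em)
  also have "(\<Sum>s\<in>C. prob {\<omega>\<in>space M. n \<omega> \<in> E (own s) (oth s)}) =
      (\<Sum>v<2 ^ K. \<Sum>u<2 ^ L. prob {\<omega>\<in>space M. n \<omega> \<in> E (level K v * d) (level L u * d)})"
    by (rule sumC[of "\<lambda>a b. prob {\<omega>\<in>space M. n \<omega> \<in> E a b}"])
  also have "\<dots> = (\<Sum>v<2 ^ K. F (\<lambda>t. even t \<noteq> even (run K k v)) (level K v)) / 2"
  proof -
    have "(\<Sum>u<2 ^ L. prob {\<omega>\<in>space M. n \<omega> \<in> E (level K v * d) (level L u * d)}) =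
        F (\<lambda>t. even t \<noteq> even (run K k v)) (level K v) / 2" if "v < 2 ^ K" for v
      unfolding F_def E(2)[OF that] sum_divide_distrib[symmetric]
      by (subst sum.swap) (rule refl)
    then show ?thesis unfolding sum_divide_distrib by (intro sum.cong refl) (simp only: lessThan_iff)
  qed
  \<comment> \<open>Odd runs carry the bit 0, so their errors come from the even runs, and
    conversely.\<close>
  also have "(\<Sum>v<2 ^ K. F (\<lambda>t. even t \<noteq> even (run K k v)) (level K v)) =
      (\<Sum>v | v < 2 ^ K \<and> odd (run K k v). F even (level K v))
    + (\<Sum>v | v < 2 ^ K \<and> even (run K k v). F odd (level K v))"
  proof -
    have "{..<2 ^ K} = {v. v < 2 ^ K \<and> odd (run K k v)} \<union> {v. v < 2 ^ K \<and> even (run K k v)}" by auto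
    moreover have "(\<Sum>v\<in>{v. v < 2 ^ K \<and> odd (run K k v)} \<union> {v. v < 2 ^ K \<and> even (run K k v)}.
        F (\<lambda>t. even t \<noteq> even (run K k v)) (level K v)) =
      (\<Sum>v | v < 2 ^ K \<and> odd (run K k v). F (\<lambda>t. even t \<noteq> even (run K k v)) (level K v))
    + (\<Sum>v | v < 2 ^ K \<and> even (run K k v). F (\<lambda>t. even t \<noteq> even (run K k v)) (level K v))"
      by (rule sum.union_disjoint) auto
    ultimately show ?thesis by simp
  qed
  also have "(\<Sum>v | v < 2 ^ K \<and> odd (run K k v). F even (level K v)) =
      (\<Sum>pb0\<in>pbar0_set k. \<Sum>j0\<in>j0_set K k pb0. F even (A0 K k pb0 j0))"
    by (rule sum_pbar0_set[OF k, symmetric])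
  also have "(\<Sum>v | v < 2 ^ K \<and> even (run K k v). F odd (level K v)) =
      (\<Sum>pb1\<in>pbar1_set k. \<Sum>j1\<in>j1_set K k pb1. F odd (A1 K k pb1 j1))"
    by (rule sum_pbar1_set[OF k, symmetric])
  \<comment> \<open>The even runs are the regions deciding for 1, indexed by
    \<open>p1_set k\<close>; the interfering index \<open>u\<close> becomes
    \<open>q\<close>.\<close>
  also have "F even = (\<lambda>x. \<Sum>p1\<in>p1_set k. \<Sum>q = - (int (2 ^ L) div 2)..int (2 ^ L) div 2 - 1.
      H x (2 * real_of_int q + 1) (delta1_l K k p1) (delta1_u K k p1))"
    unfolding F_def sum_p1_set[OF k(1), where f = "\<lambda>a b. \<Sum>q = _.._. H _ (2 * real_of_int q + 1) a b"]
    by (simp only: sum_level[OF L, where f = "\<lambda>y. H _ y _ _"])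
  also have "F odd = (\<lambda>x. \<Sum>p0\<in>p0_set k. \<Sum>q = - (int (2 ^ L) div 2)..int (2 ^ L) div 2 - 1.
      H x (2 * real_of_int q + 1) (delta0_l K k p0) (delta0_u K k p0))"
    unfolding F_def sum_p0_set[OF k(1), where f = "\<lambda>a b. \<Sum>q = _.._. H _ (2 * real_of_int q + 1) a b"]
    by (simp only: sum_level[OF L, where f = "\<lambda>y. H _ y _ _"])
  finally show ?thesis
    unfolding C(2) H_def by simp
qed

lemma sum_lessThan_add:
  fixes f :: "nat \<Rightarrow> 'a::comm_monoid_add"
  shows "(\<Sum>b<m + n. f b) = (\<Sum>b<m. f b) + (\<Sum>b<n. f (m + b))"
  by (induction n) (simp_all add: add.assoc)

theorem mainTheorem3:
  fixes \<Omega> :: "'w measure"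
    and m\<^sub>I m\<^sub>Q M\<^sub>I M\<^sub>Q :: nat
    and E\<^sub>b N\<^sub>0 \<theta> d \<alpha> :: real
    and S :: "'w \<Rightarrow> real \<times> real"
    and n\<^sub>I n\<^sub>Q :: "'w \<Rightarrow> real"
    and D\<^sub>I D\<^sub>Q :: "real \<Rightarrow> real"
    and C :: "(real \<times> real) set"
    and dec\<^sub>I dec\<^sub>Q :: "'w \<Rightarrow> real"
    and Pe\<^sub>I Pe\<^sub>Q :: "nat \<Rightarrow> real"
  assumes m: "m\<^sub>I \<ge> 1" "m\<^sub>Q \<ge> 1"
    and M: "M\<^sub>I = 2 ^ m\<^sub>I" "M\<^sub>Q = 2 ^ m\<^sub>Q"
    and pos: "E\<^sub>b > 0" "N\<^sub>0 > 0"
    and \<theta>: "\<theta> \<in> {- pi..pi}"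
    and d: "d = sqrt (3 * log 2 (real M\<^sub>I * real M\<^sub>Q) * E\<^sub>b / ((real M\<^sub>I)\<^sup>2 + (real M\<^sub>Q)\<^sup>2 - 2))"
    and \<alpha>: "\<alpha> = d / sqrt N\<^sub>0"
    and \<Omega>: "prob_space \<Omega>"
    and C: "C = amplitudes m\<^sub>I d \<times> amplitudes m\<^sub>Q d"
    and S: "S \<in> measurable \<Omega> (count_space C)"
           "distr \<Omega> (count_space C) S = uniform_count_measure C"
    and n\<^sub>I: "distributed \<Omega> lborel n\<^sub>I (normal_density 0 (sqrt (N\<^sub>0 / 2)))"
            "indep_rv \<Omega> (count_space C) S borel n\<^sub>I"
    and n\<^sub>Q: "distributed \<Omega> lborel n\<^sub>Q (normal_density 0 (sqrt (N\<^sub>0 / 2)))"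
            "indep_rv \<Omega> (count_space C) S borel n\<^sub>Q"
    and D: "nearest_rule m\<^sub>I d D\<^sub>I" "nearest_rule m\<^sub>Q d D\<^sub>Q"
    and dec: "dec\<^sub>I = (\<lambda>\<omega>. D\<^sub>I (received_I \<theta> (S \<omega>) (n\<^sub>I \<omega>)))"
             "dec\<^sub>Q = (\<lambda>\<omega>. D\<^sub>Q (received_Q \<theta> (S \<omega>) (n\<^sub>Q \<omega>)))"
    and Pe\<^sub>I: "Pe\<^sub>I = (\<lambda>k. 1 / real (m\<^sub>I + m\<^sub>Q) * bit_error_prob \<Omega> m\<^sub>I d (\<lambda>\<omega>. fst (S \<omega>)) dec\<^sub>I k)"
    and Pe\<^sub>Q: "Pe\<^sub>Q = (\<lambda>k. 1 / real (m\<^sub>I + m\<^sub>Q) * bit_error_prob \<Omega> m\<^sub>Q d (\<lambda>\<omega>. snd (S \<omega>)) dec\<^sub>Q k)"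
  shows "bit_error_rate \<Omega> m\<^sub>I m\<^sub>Q d S (\<lambda>\<omega>. (dec\<^sub>I \<omega>, dec\<^sub>Q \<omega>)) =
           (\<Sum>k = 1..m\<^sub>I. Pe\<^sub>I k) + (\<Sum>k = 1..m\<^sub>Q. Pe\<^sub>Q k)
    \<and> (\<forall>k\<in>{1..m\<^sub>I}. Pe\<^sub>I k = 1 / (2 * real (m\<^sub>I + m\<^sub>Q) * real M\<^sub>I * real M\<^sub>Q) *
         ((\<Sum>pb0\<in>pbar0_set k. \<Sum>j0\<in>j0_set m\<^sub>I k pb0. \<Sum>p1\<in>p1_set k.
             \<Sum>q = - (int M\<^sub>Q div 2)..int M\<^sub>Q div 2 - 1.
               Psi \<alpha> (delta1_l m\<^sub>I k p1) (- A0 m\<^sub>I k pb0 j0) (2 * real_of_int q + 1) \<theta>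
             - Psi \<alpha> (delta1_u m\<^sub>I k p1) (- A0 m\<^sub>I k pb0 j0) (2 * real_of_int q + 1) \<theta>)
        + (\<Sum>pb1\<in>pbar1_set k. \<Sum>j1\<in>j1_set m\<^sub>I k pb1. \<Sum>p0\<in>p0_set k.
             \<Sum>q = - (int M\<^sub>Q div 2)..int M\<^sub>Q div 2 - 1.
               Psi \<alpha> (delta0_l m\<^sub>I k p0) (- A1 m\<^sub>I k pb1 j1) (2 * real_of_int q + 1) \<theta>
             - Psi \<alpha> (delta0_u m\<^sub>I k p0) (- A1 m\<^sub>I k pb1 j1) (2 * real_of_int q + 1) \<theta>)))
    \<and> (\<forall>k\<in>{1..m\<^sub>Q}. Pe\<^sub>Q k = 1 / (2 * real (m\<^sub>I + m\<^sub>Q) * real M\<^sub>I * real M\<^sub>Q) *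
         ((\<Sum>pb0\<in>pbar0_set k. \<Sum>j0\<in>j0_set m\<^sub>Q k pb0. \<Sum>p1\<in>p1_set k.
             \<Sum>i = - (int M\<^sub>I div 2)..int M\<^sub>I div 2 - 1.
               Psi \<alpha> (delta1_l m\<^sub>Q k p1) (- A0 m\<^sub>Q k pb0 j0) (- (2 * real_of_int i + 1)) \<theta>
             - Psi \<alpha> (delta1_u m\<^sub>Q k p1) (- A0 m\<^sub>Q k pb0 j0) (- (2 * real_of_int i + 1)) \<theta>)
        + (\<Sum>pb1\<in>pbar1_set k. \<Sum>j1\<in>j1_set m\<^sub>Q k pb1. \<Sum>p0\<in>p0_set k.
             \<Sum>i = - (int M\<^sub>I div 2)..int M\<^sub>I div 2 - 1.
               Psi \<alpha> (delta0_l m\<^sub>Q k p0) (- A1 m\<^sub>Q k pb1 j1) (- (2 * real_of_int i + 1)) \<theta>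
             - Psi \<alpha> (delta0_u m\<^sub>Q k p0) (- A1 m\<^sub>Q k pb1 j1) (- (2 * real_of_int i + 1)) \<theta>)))"
proof -
  interpret prob_space \<Omega> by (rule \<Omega>)
  \<comment> \<open>Both constellation sizes are at least 2, so the logarithm and the denominator
    under the root are positive and \<open>d > 0\<close>.\<close>
  have "(2::real) ^ 1 \<le> 2 ^ m\<^sub>I" "(2::real) ^ 1 \<le> 2 ^ m\<^sub>Q" using m by (intro power_increasing; simp)+
  then have M2: "2 \<le> real M\<^sub>I" "2 \<le> real M\<^sub>Q" unfolding M by simp_all
  then have "2\<^sup>2 \<le> (real M\<^sub>I)\<^sup>2" "2\<^sup>2 \<le> (real M\<^sub>Q)\<^sup>2" using power_mono[OF M2(1), of 2] power_mono[OF M2(2), of 2] by simp_all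
  moreover have "2 * 2 \<le> real M\<^sub>I * real M\<^sub>Q" using M2 by (intro mult_mono) auto
  ultimately have d0: "d > 0" unfolding d using pos by (auto intro!: divide_pos_pos mult_pos_pos)
  note amp = amplitudes_eq_level[OF m(1), of d] amplitudes_eq_level[OF m(2), of d]
  have injI: "inj_on (\<lambda>v. level m\<^sub>I v * d) A" and injQ: "inj_on (\<lambda>v. level m\<^sub>Q v * d) A" for A
    using inj_level[of d] d0 by (auto intro: inj_on_subset)
  have C': "finite C" "card C = 2 ^ m\<^sub>I * 2 ^ m\<^sub>Q"
    unfolding C amp by (simp_all add: card_cartesian_product card_image[OF injI] card_image[OF injQ])
  have sumC: "(\<Sum>s\<in>C. G (fst s) (snd s)) =
      (\<Sum>v<2 ^ m\<^sub>I. \<Sum>u<2 ^ m\<^sub>Q. G (level m\<^sub>I v * d) (level m\<^sub>Q u * d))" for G :: "real \<Rightarrow> real \<Rightarrow> real"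
    unfolding C amp sum.cartesian_product' by (simp add: sum.reindex[OF injI] sum.reindex[OF injQ])
  have sumC': "(\<Sum>s\<in>C. G (snd s) (fst s)) =
      (\<Sum>v<2 ^ m\<^sub>Q. \<Sum>u<2 ^ m\<^sub>I. G (level m\<^sub>Q v * d) (level m\<^sub>I u * d))" for G :: "real \<Rightarrow> real \<Rightarrow> real"
    unfolding sumC[of "\<lambda>a b. G b a"] by (rule sum.swap)
  have inC: "fst s \<in> amplitudes m\<^sub>I d" "snd s \<in> amplitudes m\<^sub>Q d" if "s \<in> C" for s
    using that unfolding C by auto
  have rate: "bit_error_rate \<Omega> m\<^sub>I m\<^sub>Q d S (\<lambda>\<omega>. (dec\<^sub>I \<omega>, dec\<^sub>Q \<omega>)) =
           (\<Sum>k = 1..m\<^sub>I. Pe\<^sub>I k) + (\<Sum>k = 1..m\<^sub>Q. Pe\<^sub>Q k)"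
  proof -
    \<comment> \<open>I codewords have length \<open>m\<^sub>I\<close>, so the appended word has I
      bit \<open>b + 1\<close> at position \<open>b < m\<^sub>I\<close> and Q bit
      \<open>b + 1\<close> at position \<open>m\<^sub>I + b\<close>.\<close>
    have lenC: "length (codeword K d a) = K" if a: "a \<in> amplitudes K d" "K \<ge> 1" for K a
    proof -
      obtain v where "v < 2 ^ K" "a = level K v * d" using a(1) unfolding amplitudes_eq_level[OF a(2)] by blast
      then show ?thesis using codeword_level[OF d0] length_codeword_gray length_gray by (metis nth_mem)
    qed
    have SC: "S \<omega> \<in> C" if "\<omega> \<in> space \<Omega>" for \<omega> using measurable_space[OF S(1) that] by simp
    have "D\<^sub>I r \<in> amplitudes m\<^sub>I d" for r using D(1) by (auto simp: nearest_rule_def is_arg_min_def)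
    then have len: "length (codeword m\<^sub>I d (dec\<^sub>I \<omega>)) = m\<^sub>I" for \<omega>
      unfolding dec(1) using lenC m(1) by blast
    have lenS: "length (codeword m\<^sub>I d (fst (S \<omega>))) = m\<^sub>I" if "\<omega> \<in> space \<Omega>" for \<omega>
      using lenC m(1) inC(1) SC that by blast
    let ?P = "\<lambda>b. \<P>(\<omega> in \<Omega>. symbol_bits m\<^sub>I m\<^sub>Q d (dec\<^sub>I \<omega>, dec\<^sub>Q \<omega>) ! b \<noteq> symbol_bits m\<^sub>I m\<^sub>Q d (S \<omega>) ! b)"
    have I: "?P b = bit_error_prob \<Omega> m\<^sub>I d (\<lambda>\<omega>. fst (S \<omega>)) dec\<^sub>I (Suc b)" if "b < m\<^sub>I" for b
      unfolding bit_error_prob_def using that len lenS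
      by (intro arg_cong[where f = prob]) (auto simp: symbol_bits_def kth_bit_def nth_append)
    have Q: "?P (m\<^sub>I + b) = bit_error_prob \<Omega> m\<^sub>Q d (\<lambda>\<omega>. snd (S \<omega>)) dec\<^sub>Q (Suc b)" for b
      unfolding bit_error_prob_def using len lenS
      by (intro arg_cong[where f = prob]) (auto simp: symbol_bits_def kth_bit_def nth_append)
    have "(\<Sum>b<m\<^sub>I + m\<^sub>Q. ?P b) = (\<Sum>b<m\<^sub>I. ?P b) + (\<Sum>b<m\<^sub>Q. ?P (m\<^sub>I + b))"
      by (rule sum_lessThan_add)
    also have "\<dots> = (\<Sum>k = 1..m\<^sub>I. bit_error_prob \<Omega> m\<^sub>I d (\<lambda>\<omega>. fst (S \<omega>)) dec\<^sub>I k)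
        + (\<Sum>k = 1..m\<^sub>Q. bit_error_prob \<Omega> m\<^sub>Q d (\<lambda>\<omega>. snd (S \<omega>)) dec\<^sub>Q k)"
      using I Q by (simp add: sum.atLeast1_atMost_eq)
    finally show ?thesis
      unfolding bit_error_rate_def Pe\<^sub>I Pe\<^sub>Q by (simp add: add_divide_distrib sum_divide_distrib)
  qed
  have decI: "dec\<^sub>I = (\<lambda>\<omega>. D\<^sub>I (fst (S \<omega>) * cos \<theta> - 1 * snd (S \<omega>) * sin \<theta> + n\<^sub>I \<omega>))"
    unfolding dec received_I_def by simp
  \<comment> \<open>Exchanging the two components brings the Q channel to the common form, with the
    sign of the sine term reversed.\<close>
  have decQ: "dec\<^sub>Q = (\<lambda>\<omega>. D\<^sub>Q (snd (S \<omega>) * cos \<theta> - (- 1) * fst (S \<omega>) * sin \<theta> + n\<^sub>Q \<omega>))"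
    unfolding dec received_Q_def by (simp add: add.commute)
  show ?thesis
  proof (intro conjI ballI)
    fix k assume "k \<in> {1..m\<^sub>I}"
    then have k: "1 \<le> k" "k \<le> m\<^sub>I" by auto
    show "Pe\<^sub>I k = 1 / (2 * real (m\<^sub>I + m\<^sub>Q) * real M\<^sub>I * real M\<^sub>Q) *
         ((\<Sum>pb0\<in>pbar0_set k. \<Sum>j0\<in>j0_set m\<^sub>I k pb0. \<Sum>p1\<in>p1_set k.
             \<Sum>q = - (int M\<^sub>Q div 2)..int M\<^sub>Q div 2 - 1.
               Psi \<alpha> (delta1_l m\<^sub>I k p1) (- A0 m\<^sub>I k pb0 j0) (2 * real_of_int q + 1) \<theta>
             - Psi \<alpha> (delta1_u m\<^sub>I k p1) (- A0 m\<^sub>I k pb0 j0) (2 * real_of_int q + 1) \<theta>)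
        + (\<Sum>pb1\<in>pbar1_set k. \<Sum>j1\<in>j1_set m\<^sub>I k pb1. \<Sum>p0\<in>p0_set k.
             \<Sum>q = - (int M\<^sub>Q div 2)..int M\<^sub>Q div 2 - 1.
               Psi \<alpha> (delta0_l m\<^sub>I k p0) (- A1 m\<^sub>I k pb1 j1) (2 * real_of_int q + 1) \<theta>
             - Psi \<alpha> (delta0_u m\<^sub>I k p0) (- A1 m\<^sub>I k pb1 j1) (2 * real_of_int q + 1) \<theta>))"
      unfolding Pe\<^sub>I decI \<alpha> M
      by (subst channel_bit_error_prob[OF d0 k m(2) D(1) pos(2) n\<^sub>I(1) C' S n\<^sub>I(2) sumC inC(1)]) simp_all
  next
    fix k assume "k \<in> {1..m\<^sub>Q}"
    then have k: "1 \<le> k" "k \<le> m\<^sub>Q" by auto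
    have C'': "card C = 2 ^ m\<^sub>Q * 2 ^ m\<^sub>I" using C' by simp
    show "Pe\<^sub>Q k = 1 / (2 * real (m\<^sub>I + m\<^sub>Q) * real M\<^sub>I * real M\<^sub>Q) *
         ((\<Sum>pb0\<in>pbar0_set k. \<Sum>j0\<in>j0_set m\<^sub>Q k pb0. \<Sum>p1\<in>p1_set k.
             \<Sum>i = - (int M\<^sub>I div 2)..int M\<^sub>I div 2 - 1.
               Psi \<alpha> (delta1_l m\<^sub>Q k p1) (- A0 m\<^sub>Q k pb0 j0) (- (2 * real_of_int i + 1)) \<theta>
             - Psi \<alpha> (delta1_u m\<^sub>Q k p1) (- A0 m\<^sub>Q k pb0 j0) (- (2 * real_of_int i + 1)) \<theta>)
        + (\<Sum>pb1\<in>pbar1_set k. \<Sum>j1\<in>j1_set m\<^sub>Q k pb1. \<Sum>p0\<in>p0_set k.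
             \<Sum>i = - (int M\<^sub>I div 2)..int M\<^sub>I div 2 - 1.
               Psi \<alpha> (delta0_l m\<^sub>Q k p0) (- A1 m\<^sub>Q k pb1 j1) (- (2 * real_of_int i + 1)) \<theta>
             - Psi \<alpha> (delta0_u m\<^sub>Q k p0) (- A1 m\<^sub>Q k pb1 j1) (- (2 * real_of_int i + 1)) \<theta>))"
      unfolding Pe\<^sub>Q decQ \<alpha> M
      by (subst channel_bit_error_prob[OF d0 k m(1) D(2) pos(2) n\<^sub>Q(1) C'(1) C'' S n\<^sub>Q(2) sumC' inC(2)])
        (simp_all add: mult_ac)
  qed (rule rate)
qed

end
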